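(* In the setting described in the context, suppose that $(F_0)_{ii}=(F_0)_{jj}$ with $i\neq j$ is a double eigenvalue of $F_0$. Then the first order effective Hamiltonian associated to $(F_0)_{ii}$ is given by $$\begin{pmatrix}(F_0)_{ii}&0\\0&(F_0)_{jj}\end{pmatrix}+\epsilon\begin{pmatrix}(A_1^{(0)})_{ii}&(A_1^{(n_i-n_j)})_{ij}\\(A_1^{(n_j-n_i)})_{ji}&(A_1^{(0)})_{jj}\end{pmatrix}.$$ Furthermore, up to first order in $\epsilon$, the Floquet exponents associated to $(F_0)_{ii}$ are given by $$(F_0)_{ii}+\epsilon\left(\frac{(A_1^{(0)})_{ii}+(A_1^{(0)})_{jj}}{2}\pm\sqrt{\left(\frac{(A_1^{(0)})_{ii}-(A_1^{(0)})_{jj}}{2}\right)^2+(A_1^{(n_i-n_j)})_{ij}(A_1^{(n_j-n_i)})_{ji}}\right).$$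
   Context: Setting: $T>0$ and $A_\epsilon(t)=A_0+\epsilon A_1(t)+\epsilon^2A_2(t)+\ldots\in\mathbb{C}^{N\times N}$ is $T$-periodic and continuous in $t$, analytic in $\epsilon$ near $0$; $A_0$ is diagonal and constant in $t$; each $A_n(t)$, $n\ge1$, has a finite Fourier series $A_n(t)=\sum_m e^{2\pi \mathrm{i} mt/T}A_n^{(m)}$; the series converges for $|\epsilon|<r_0$ with $r_0$ independent of $t$. $F_0$ is the diagonal matrix with diagonal entries of $A_0-F_0$ in $\frac{2\pi \mathrm{i}}{T}\mathbb{Z}$ and imaginary parts of its diagonal entries in $(-\frac{\pi}{T},\frac{\pi}{T}]$; $n_k=\frac{T}{2\pi \mathrm{i}}(A_0-F_0)_{kk}\in\mathbb{Z}$ is the folding number of $(F_0)_{kk}$. Let $X_\epsilon(t)=P_\epsilon(t)\exp(F_\epsilon t)$ be the decomposition of the fundamental solution ($X_\epsilon(0)=\mathrm{Id}$) of $\frac{dx}{dt}=A_\epsilon(t)x$ that is analytic in $\epsilon$, with $P_\epsilon$ being $T$-periodic in $t$, $P_\epsilon(0)=\mathrm{Id}$, $F_\epsilon=F_0+\epsilon F_1+\epsilon^2F_2+\ldots$ and $P_\epsilon=P_0+\epsilon P_1+\ldots$, $P_0(t)=\exp((A_0-F_0)t)$. The Floquet exponents are the eigenvalues of $F_\epsilon$; those associated to $(F_0)_{ii}$ are the ones converging to $(F_0)_{ii}$ as $\epsilon\to0$. The first order effective Hamiltonian associated to $(F_0)_{ii}$ is the compression of $F_0+\epsilon F_1$ (rows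 and columns) to $\mathrm{span}\{e_l:(F_0)_{ll}=(F_0)_{ii}\}$. *)

theory Defs
  imports
    "HOL-Analysis.Analysis"
    "HOL-Computational_Algebra.Fundamental_Theorem_Algebra"
    "HOL-Library.Landau_Symbols"
begin

(* On vectors of vectors, the library's "*", "^" and "exp"-style operations are componentwise or
   unavailable, so the matrix operations are spelled out in terms of "**" and "mat 1". *)

definition cscale :: "complex \<Rightarrow> complex ^ 'm ^ 'n \<Rightarrow> complex ^ 'm ^ 'n" (infixr "*\<^sub>C" 75) where
  "c *\<^sub>C M = map_matrix (\<lambda>x. c * x) M"

definition mexp :: "complex ^ 'n ^ 'n \<Rightarrow> complex ^ 'n ^ 'n" where
  "mexp M = (\<Sum>k. (1 / fact k) *\<^sub>R (((**) M ^^ k) (mat 1)))"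

definition diagonal :: "complex ^ 'n ^ 'n \<Rightarrow> bool" where
  "diagonal M \<longleftrightarrow> (\<forall>k l. k \<noteq> l \<longrightarrow> M $ k $ l = 0)"

definition charpoly :: "complex ^ 'n ^ 'n \<Rightarrow> complex poly" where
  "charpoly M = det (mat [:0, 1:] - map_matrix (\<lambda>x. [:x:]) M)"

(* Eigenvalues counted with algebraic multiplicity. *)
definition eigenvalues :: "complex ^ 'n ^ 'n \<Rightarrow> complex multiset" where
  "eigenvalues M = proots (charpoly M)"

lemma poly_charpoly: "poly (charpoly M) z = det (mat z - M)"
  unfolding charpoly_def det_def
  by (auto simp: poly_sum poly_prod mat_def intro!: sum.cong prod.cong)

lemma charpoly_nonzero: "charpoly M \<noteq> 0"
proof
  assume "charpoly M = 0"
  hence "det (mat z - M) = 0" for z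
    by (metis poly_charpoly poly_0)
  hence *: "det (mat 1 - (1 / of_nat n) *\<^sub>C M) = 0" if "n > 0" for n :: nat
  proof -
    have "mat 1 - (1 / of_nat n) *\<^sub>C M = (\<chi> i. (1 / of_nat n) *s ((mat (of_nat n) - M) $ i))"
      using that by (auto simp: vec_eq_iff mat_def cscale_def field_simps)
    thus ?thesis
      using \<open>\<And>z. det (mat z - M) = 0\<close>
      by (simp only: det_rows_mul vec_lambda_eta mult_zero_right)
  qed
  have "(\<lambda>n. a - (1 / of_nat (Suc n)) * b) \<longlonglongrightarrow> a - 0 * b" for a b :: complex
    by (intro tendsto_intros lim_1_over_n[THEN LIMSEQ_Suc])
  hence "(\<lambda>n. det (mat 1 - (1 / of_nat (Suc n)) *\<^sub>C M)) \<longlonglongrightarrow> det (mat 1 - 0 *\<^sub>C M)"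
    unfolding det_def cscale_def vector_minus_component nth_map_matrix
    by (intro tendsto_sum tendsto_mult tendsto_const tendsto_prod)
  hence "(\<lambda>n::nat. 0) \<longlonglongrightarrow> det (mat 1 - 0 *\<^sub>C M)"
    using * by (simp del: of_nat_Suc)
  moreover have "mat 1 - 0 *\<^sub>C M = mat 1"
    by (simp add: vec_eq_iff cscale_def)
  ultimately show False
    by (simp add: LIMSEQ_const_iff)
qed

lemma set_eigenvalues:
  "z \<in># eigenvalues M \<longleftrightarrow> (\<exists>v. v \<noteq> 0 \<and> M *v v = z *s v)"
proof -
  have "mat z *v v = z *s v" for v :: "complex ^ 'n"
    by (simp add: vec_eq_iff mat_def matrix_vector_mult_def if_distrib[of "\<lambda>x. x * _"] cong: if_cong)
  hence "(mat z - M) *v v = 0 \<longleftrightarrow> M *v v = z *s v" for v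
    by (metis matrix_vector_mult_diff_rdistrib right_minus_eq)
  moreover have "det (mat z - M) = 0 \<longleftrightarrow> (\<exists>v. v \<noteq> 0 \<and> (mat z - M) *v v = 0)"
    using invertible_det_nz[of "mat z - M"] invertible_left_inverse[of "mat z - M"]
      matrix_left_invertible_ker[of "mat z - M"] by auto
  ultimately show ?thesis
    by (simp add: eigenvalues_def charpoly_nonzero poly_charpoly)
qed

(* H is the first order effective Hamiltonian associated to the k-th diagonal entry of F0, i.e. the
   compression of F0 + eps F1 to the span of the e_l with equal diagonal entry, written in the
   ordered basis of that span formed by the e_(b a). *)
definition first_order_effective_hamiltonian ::
  "complex ^ 'n ^ 'n \<Rightarrow> complex ^ 'n ^ 'n \<Rightarrow> 'n \<Rightarrow> ('d \<Rightarrow> 'n) \<Rightarrow> (complex \<Rightarrow> complex ^ 'd ^ 'd) \<Rightarrow> bool"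
where
  "first_order_effective_hamiltonian F0 F1 k b H \<longleftrightarrow>
     bij_betw b UNIV {l. F0 $ l $ l = F0 $ k $ k} \<and>
     (\<forall>\<epsilon>. H \<epsilon> = (\<chi> p q. (F0 + \<epsilon> *\<^sub>C F1) $ b p $ b q))"

(* The functions in ls list, with algebraic multiplicity, precisely those eigenvalues of F eps
   that converge to f as eps tends to 0: the remaining ones eventually stay away from f. *)
definition exponents_associated ::
  "(complex \<Rightarrow> complex ^ 'n ^ 'n) \<Rightarrow> complex \<Rightarrow> (complex \<Rightarrow> complex) list \<Rightarrow> bool"
where
  "exponents_associated F f ls \<longleftrightarrow>
     (\<forall>l\<in>set ls. (l \<longlongrightarrow> f) (at 0)) \<and>
     (\<exists>\<delta>>0. \<forall>\<^sub>F \<epsilon> in at 0. {#z \<in># eigenvalues (F \<epsilon>). dist z f < \<delta>#} = mset (map (\<lambda>l. l \<epsilon>) ls))"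

end

theory Submission
  imports Defs
begin

text \<open>
  The perturbation acts to first order only through the monodromy matrix. Since \<open>P\<^sub>\<epsilon>\<close> is
  \<open>T\<close>-periodic with \<open>P\<^sub>\<epsilon>(0) = Id\<close>, the fundamental solution satisfies
  \<open>X\<^sub>\<epsilon>(T) = exp (T F\<^sub>\<epsilon>)\<close>, and both sides are values at time \<open>T\<close> of solutions of linear
  differential equations: one with coefficient \<open>A\<^sub>\<epsilon>(t)\<close>, one with constant coefficient
  \<open>F\<^sub>\<epsilon>\<close>. For either of them, passing to the frame that rotates with the diagonal unperturbed
  flow leaves an equation with a coefficient of size \<open>\<epsilon>\<close>, whose solution is the identity plus the
  integral of the coefficient, up to \<open>O(\<epsilon>\<^sup>2)\<close> (lemma \<open>linear_ode_first_order\<close>).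
  Comparing the coefficients of \<open>\<epsilon>\<close> in the entry \<open>(k, l)\<close> with
  \<open>(F\<^sub>0)\<^sub>k\<^sub>k = (F\<^sub>0)\<^sub>l\<^sub>l\<close>, the constant side contributes \<open>T (F\<^sub>1)\<^sub>k\<^sub>l\<close>, whereas
  the rotation turns the other side into a Fourier coefficient: the frequencies of \<open>A\<^sub>0\<close> at
  \<open>k\<close> and \<open>l\<close> differ by \<open>2\<pi>i (n\<^sub>k - n\<^sub>l) / T\<close>, so that only the Fourier mode
  \<open>n\<^sub>k - n\<^sub>l\<close> of \<open>A\<^sub>1\<close> survives the integration over a period. This identifies the
  effective Hamiltonian (lemma \<open>first_order_floquet_entry\<close>).

  The splitting of the double eigenvalue \<open>f\<close> needs only \<open>F\<^sub>\<epsilon> = F\<^sub>0 + \<epsilon> F\<^sub>1 + O(\<epsilon>\<^sup>2)\<close>.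
  Roots of monic polynomials depend continuously on the coefficients, so exactly two eigenvalues
  \<open>f + \<epsilon> w\<^sub>1\<close>, \<open>f + \<epsilon> w\<^sub>2\<close> stay near \<open>f\<close>. In
  \<open>det (f + \<epsilon> w - F\<^sub>\<epsilon>)\<close> the two rows that belong to \<open>f\<close> are divisible by \<open>\<epsilon>\<close>;
  after division by \<open>\<epsilon>\<^sup>2\<close> the determinant is, up to \<open>O(\<epsilon>)\<close>, a nonzero constant times the
  characteristic polynomial at \<open>w\<close> of the two by two block of \<open>F\<^sub>1\<close>. The remaining
  eigenvalues contribute a factor that is independent of \<open>w\<close> up to a relative error \<open>O(\<epsilon>)\<close>,
  hence \<open>(w - w\<^sub>1)(w - w\<^sub>2)\<close> agrees with that block's characteristic polynomial up to
  \<open>O(\<epsilon>)\<close>. The sum and the product of the \<open>w\<close>'s are therefore known up to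
  \<open>O(\<epsilon>)\<close>, and so is the square of half their difference, which tends to the discriminant
  \<open>D\<close>. Extracting the square root keeps the error \<open>O(\<epsilon>)\<close> if \<open>D \<noteq> 0\<close>, and leaves an error
  that merely tends to zero if \<open>D = 0\<close> (lemma \<open>double_eigenvalue_splitting\<close>).
\<close>

section \<open>Complex matrices with the Frobenius norm\<close>

lemma cscale_nth [simp]: "(c *\<^sub>C M) $ k $ l = c * M $ k $ l"
  by (simp add: cscale_def)

lemma norm_cscale: "norm (c *\<^sub>C M) = norm c * norm M"
  by (simp add: norm_vec_def norm_mult L2_set_right_distrib)

lemma norm_matrix_nth_le: "norm (M $ k $ l) \<le> norm (M :: complex ^ 'm ^ 'n)"
  by (meson Finite_Cartesian_Product.norm_nth_le order_trans)

lemma norm_matrix_squared: "norm (M :: complex ^ 'm ^ 'n) ^ 2 = (\<Sum>k\<in>UNIV. \<Sum>l\<in>UNIV. norm (M $ k $ l) ^ 2)"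
  by (simp add: norm_vec_def L2_set_def sum_nonneg)

lemma norm_matrix_le_entries:
  fixes M :: "complex ^ 'm ^ 'n" and N :: "complex ^ 'm ^ 'n"
  assumes "\<And>k l. norm (M $ k $ l) \<le> b * norm (N $ k $ l)" "b \<ge> 0"
  shows "norm M \<le> b * norm N"
proof (rule power2_le_imp_le)
  have "norm M ^ 2 \<le> (\<Sum>k\<in>UNIV. \<Sum>l\<in>UNIV. (b * norm (N $ k $ l)) ^ 2)"
    unfolding norm_matrix_squared using assms by (intro sum_mono power_mono) auto
  thus "norm M ^ 2 \<le> (b * norm N) ^ 2"
    by (simp add: norm_matrix_squared[of N] power_mult_distrib sum_distrib_left)
qed (use assms in auto)

text \<open>The norm of a vector of vectors is the Frobenius norm, so the Cauchy-Schwarz inequality for each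
  entry of the product makes it submultiplicative.\<close>

lemma norm_matrix_mult_le:
  fixes A :: "complex ^ 'm ^ 'n" and B :: "complex ^ 'p ^ 'm"
  shows "norm (A ** B) \<le> norm A * norm B"
proof (rule power2_le_imp_le)
  have entry: "norm ((A ** B) $ k $ l) ^ 2 \<le>
      (\<Sum>m\<in>UNIV. norm (A $ k $ m) ^ 2) * (\<Sum>m\<in>UNIV. norm (B $ m $ l) ^ 2)" for k l
  proof -
    have "norm ((A ** B) $ k $ l) \<le> (\<Sum>m\<in>UNIV. \<bar>norm (A $ k $ m)\<bar> * \<bar>norm (B $ m $ l)\<bar>)"
      unfolding matrix_matrix_mult_def by (simp add: sum_norm_le norm_mult)
    also have "\<dots> \<le> L2_set (\<lambda>m. norm (A $ k $ m)) UNIV * L2_set (\<lambda>m. norm (B $ m $ l)) UNIV"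
      by (rule L2_set_mult_ineq)
    finally have "norm ((A ** B) $ k $ l) ^ 2 \<le>
        (L2_set (\<lambda>m. norm (A $ k $ m)) UNIV * L2_set (\<lambda>m. norm (B $ m $ l)) UNIV) ^ 2"
      by (intro power_mono) auto
    thus ?thesis by (simp add: power_mult_distrib L2_set_def sum_nonneg)
  qed
  have "norm (A ** B) ^ 2 \<le> (\<Sum>k\<in>UNIV. \<Sum>l\<in>UNIV.
      (\<Sum>m\<in>UNIV. norm (A $ k $ m) ^ 2) * (\<Sum>m\<in>UNIV. norm (B $ m $ l) ^ 2))"
    unfolding norm_matrix_squared[of "A ** B"] by (intro sum_mono entry)
  also have "\<dots> = norm A ^ 2 * (\<Sum>l\<in>UNIV. \<Sum>m\<in>UNIV. norm (B $ m $ l) ^ 2)"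
    by (simp add: norm_matrix_squared[of A] sum_product)
  also have "\<dots> = (norm A * norm B) ^ 2"
    by (subst sum.swap) (simp add: norm_matrix_squared[of B] power_mult_distrib)
  finally show "norm (A ** B) ^ 2 \<le> (norm A * norm B) ^ 2" .
qed simp

lemma bounded_bilinear_matrix_mult:
  "bounded_bilinear ((**) :: complex ^ 'm ^ 'n \<Rightarrow> complex ^ 'p ^ 'm \<Rightarrow> complex ^ 'p ^ 'n)"
proof (unfold_locales, goal_cases)
  case 5
  show ?case
    by (rule exI[of _ 1]) (simp add: norm_matrix_mult_le)
qed (simp_all add: vec_eq_iff matrix_matrix_mult_def distrib_left distrib_right sum.distrib scaleR_sum_right)

section \<open>Power series of matrices and the matrix exponential\<close>

lemma sums_matrix_iff:
  fixes f :: "nat \<Rightarrow> complex ^ 'm ^ 'n"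
  shows "f sums S \<longleftrightarrow> (\<forall>k l. (\<lambda>q. f q $ k $ l) sums (S $ k $ l))"
proof
  show "\<forall>k l. (\<lambda>q. f q $ k $ l) sums (S $ k $ l)" if "f sums S"
    using that by (intro allI sums_vec_nth)
  assume "\<forall>k l. (\<lambda>q. f q $ k $ l) sums (S $ k $ l)"
  thus "f sums S"
    unfolding sums_def by (intro vec_tendstoI) simp
qed

text \<open>Limits in a finite product are componentwise, and a derivative is a limit of difference
  quotients.\<close>

lemma has_vector_derivative_matrixI:
  fixes f :: "real \<Rightarrow> complex ^ 'm ^ 'n"
  assumes "\<And>k l. ((\<lambda>t. f t $ k $ l) has_vector_derivative f' $ k $ l) (at t within S)"
  shows "(f has_vector_derivative f') (at t within S)"
proof -
  have "((\<lambda>y. (1 / norm (y - t)) *\<^sub>R (f y - (f t + (y - t) *\<^sub>R f'))) \<longlongrightarrow> 0) (at t within S)"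
    using assms by (intro vec_tendstoI) (simp add: has_vector_derivative_def has_derivative_within)
  thus ?thesis
    by (simp add: has_vector_derivative_def has_derivative_within bounded_linear_scaleR_left)
qed

text \<open>Cauchy's estimate for the tail of a power series. The constant depends on the coefficients only
  through \<open>K\<close> and \<open>\<rho>\<close>, which makes the estimate uniform in the time parameter when the
  coefficients are functions of time.\<close>

lemma power_series_remainder:
  fixes a :: "nat \<Rightarrow> complex ^ 'm ^ 'n"
  assumes bound: "\<And>k. norm (a k) * \<rho> ^ k \<le> K" and "\<rho> > 0"
    and S: "(\<lambda>k. \<epsilon> ^ k *\<^sub>C a k) sums S" and small: "norm \<epsilon> \<le> \<rho> / 2"
  shows "norm (S - a 0 - \<epsilon> *\<^sub>C a 1) \<le> 2 * K / \<rho>\<^sup>2 * norm \<epsilon> ^ 2"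
proof -
  define q where "q = norm \<epsilon> / \<rho>"
  have q: "0 \<le> q" "q \<le> 1 / 2"
    using small \<open>\<rho> > 0\<close> by (auto simp: q_def field_simps)
  have K: "K \<ge> 0" using bound[of 0] by (simp add: order_trans[OF norm_ge_zero])
  have le: "norm (\<epsilon> ^ k *\<^sub>C a k) \<le> K * q ^ k" for k
  proof -
    have "norm (\<epsilon> ^ k *\<^sub>C a k) = norm (a k) * \<rho> ^ k * q ^ k"
      using \<open>\<rho> > 0\<close> by (simp add: norm_cscale norm_power q_def power_divide)
    also have "\<dots> \<le> K * q ^ k"
      using bound q by (intro mult_right_mono) auto
    finally show ?thesis .
  qed
  have tail: "(\<lambda>k. \<epsilon> ^ (k + 2) *\<^sub>C a (k + 2)) sums (S - (\<Sum>k<2. \<epsilon> ^ k *\<^sub>C a k))"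
    using sums_iff_shift[of "\<lambda>k. \<epsilon> ^ k *\<^sub>C a k" 2 "S - (\<Sum>k<2. \<epsilon> ^ k *\<^sub>C a k)"] S by simp
  have geo: "(\<lambda>k. K * q\<^sup>2 * q ^ k) sums (K * q\<^sup>2 * (1 / (1 - q)))"
    using q by (intro sums_mult geometric_sums) auto
  have "S - (\<Sum>k<2. \<epsilon> ^ k *\<^sub>C a k) = S - a 0 - \<epsilon> *\<^sub>C a 1"
    by (simp add: numeral_2_eq_2 vec_eq_iff)
  hence "norm (S - a 0 - \<epsilon> *\<^sub>C a 1) = norm (\<Sum>k. \<epsilon> ^ (k + 2) *\<^sub>C a (k + 2))"
    using sums_unique[OF tail] by simp
  also have "\<dots> \<le> (\<Sum>k. K * q\<^sup>2 * q ^ k)"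
    using le sums_summable[OF geo] by (intro norm_suminf_le) (metis mult.assoc mult.commute power_add)
  also have "\<dots> = K * q\<^sup>2 * (1 / (1 - q))"
    using geo by (simp add: sums_iff)
  also have "\<dots> \<le> K * q\<^sup>2 * 2"
    using q K by (intro mult_left_mono) (auto simp: field_simps)
  also have "\<dots> = 2 * K / \<rho>\<^sup>2 * norm \<epsilon> ^ 2"
    by (simp add: q_def power_divide)
  finally show ?thesis .
qed

text \<open>Each entry of \<open>mexp (t *\<^sub>R M)\<close> is a power series in \<open>t\<close> that converges everywhere,
  and differentiating it termwise shifts the powers of \<open>M\<close> by one. Thus the exponential is the
  fundamental solution of an equation with constant coefficient, so that the same perturbation
  result applies to it and to the periodic equation.\<close>

lemma mexp_has_vector_derivative:
  fixes M :: "complex ^ 'n ^ 'n"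
  shows "((\<lambda>t. mexp (t *\<^sub>R M)) has_vector_derivative M ** mexp (t *\<^sub>R M)) (at t)"
    and mexp_0: "mexp (0 :: complex ^ 'n ^ 'n) = mat 1"
proof -
  interpret mm: bounded_bilinear "(**) :: complex ^ 'n ^ 'n \<Rightarrow> complex ^ 'n ^ 'n \<Rightarrow> complex ^ 'n ^ 'n"
    by (rule bounded_bilinear_matrix_mult)
  define pw where "pw k = (((**) M) ^^ k) (mat 1 :: complex ^ 'n ^ 'n)" for k
  define N1 where "N1 = norm (mat 1 :: complex ^ 'n ^ 'n)"
  have pw_Suc: "pw (Suc k) = M ** pw k" for k by (simp add: pw_def)
  have pw_le: "norm (pw k) \<le> N1 * norm M ^ k" for k
  proof (induction k)
    case (Suc k)
    have "norm (pw (Suc k)) \<le> norm M * norm (pw k)"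
      unfolding pw_Suc by (rule norm_matrix_mult_le)
    also have "\<dots> \<le> norm M * (N1 * norm M ^ k)"
      using Suc by (intro mult_left_mono) auto
    finally show ?case by (simp add: mult_ac)
  qed (simp add: pw_def N1_def)
  have pw_scale: "(((**) (t *\<^sub>R M)) ^^ k) (mat 1) = t ^ k *\<^sub>R pw k" for t k
    by (induction k) (simp_all add: pw_def mm.scaleR_left mm.scaleR_right)
  define c where "c k l q = pw q $ k $ l / fact q" for k l q
  have c_sum: "summable (\<lambda>q. c k l q * y ^ q)" for k l y
  proof (rule summable_comparison_test')
    show "summable (\<lambda>q. N1 * (inverse (fact q) * (norm M * norm y) ^ q))"
      by (intro summable_mult summable_exp)
    show "norm (c k l q * y ^ q) \<le> N1 * (inverse (fact q) * (norm M * norm y) ^ q)" for q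
    proof -
      have "norm (c k l q * y ^ q) = norm (pw q $ k $ l) * (norm y ^ q / fact q)"
        by (simp add: c_def norm_mult norm_divide norm_power)
      also have "\<dots> \<le> (N1 * norm M ^ q) * (norm y ^ q / fact q)"
        by (intro mult_right_mono order_trans[OF norm_matrix_nth_le pw_le]) auto
      finally show ?thesis by (simp add: power_mult_distrib field_simps)
    qed
  qed
  have mexp_nth: "mexp (t *\<^sub>R M) $ k $ l = (\<Sum>q. c k l q * of_real t ^ q)" for t k l
  proof -
    have "(\<lambda>q. (1 / fact q) *\<^sub>R (((**) (t *\<^sub>R M)) ^^ q) (mat 1)) sums
       (\<chi> k l. \<Sum>q. c k l q * of_real t ^ q)"
      unfolding sums_matrix_iff pw_scale
    proof (intro allI)
      fix k l
      have "((1 / fact q) *\<^sub>R t ^ q *\<^sub>R pw q) $ k $ l = c k l q * of_real t ^ q" for q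
        by (simp add: c_def scaleR_conv_of_real[where 'a = complex])
      thus "(\<lambda>q. ((1 / fact q) *\<^sub>R t ^ q *\<^sub>R pw q) $ k $ l) sums
          ((\<chi> k l. \<Sum>q. c k l q * of_real t ^ q) $ k $ l)"
        using summable_sums[OF c_sum] by simp
    qed
    thus ?thesis by (simp add: mexp_def sums_iff)
  qed
  show "((\<lambda>t. mexp (t *\<^sub>R M)) has_vector_derivative M ** mexp (t *\<^sub>R M)) (at t)"
  proof (rule has_vector_derivative_matrixI)
    fix k l
    have "((\<lambda>x. \<Sum>q. c k l q * x ^ q) has_field_derivative (\<Sum>q. diffs (c k l) q * of_real t ^ q))
        (at (of_real t))"
      by (intro termdiffs_strong_converges_everywhere c_sum)
    hence "((\<lambda>x. \<Sum>q. c k l q * of_real x ^ q) has_vector_derivative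
        (\<Sum>q. diffs (c k l) q * of_real t ^ q)) (at t)"
      by (rule has_vector_derivative_real_field)
    moreover have "(\<lambda>q. \<Sum>m\<in>UNIV. M $ k $ m * (c m l q * of_real t ^ q)) sums
        (\<Sum>m\<in>UNIV. M $ k $ m * (\<Sum>q. c m l q * of_real t ^ q))"
      by (intro sums_sum sums_mult summable_sums c_sum)
    moreover have "diffs (c k l) q * of_real t ^ q = (\<Sum>m\<in>UNIV. M $ k $ m * (c m l q * of_real t ^ q))" for q
    proof -
      have "diffs (c k l) q = pw (Suc q) $ k $ l / fact q"
        by (simp add: diffs_def c_def field_simps del: of_nat_Suc)
      thus ?thesis
        by (simp add: pw_Suc matrix_matrix_mult_def c_def sum_distrib_left sum_distrib_right sum_divide_distrib mult_ac)
    qed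
    ultimately show "((\<lambda>t. mexp (t *\<^sub>R M) $ k $ l) has_vector_derivative
        (M ** mexp (t *\<^sub>R M)) $ k $ l) (at t)"
      by (simp add: mexp_nth matrix_matrix_mult_def sums_iff)
  qed
  have "mexp (0 *\<^sub>R M) $ k $ l = (mat 1 :: complex ^ 'n ^ 'n) $ k $ l" for k l
    unfolding mexp_nth of_real_0 powser_zero by (simp add: c_def pw_def)
  thus "mexp (0 :: complex ^ 'n ^ 'n) = mat 1"
    by (simp add: vec_eq_iff)
qed

section \<open>First order perturbation of linear differential equations\<close>

lemma vector_derivative_bound:
  fixes f :: "real \<Rightarrow> 'a::real_normed_vector"
  assumes f: "\<And>t. t \<in> {0..T} \<Longrightarrow> (f has_vector_derivative f' t) (at t within {0..T})"
    and B: "\<And>t. t \<in> {0..T} \<Longrightarrow> norm (f' t) \<le> B" and t: "t \<in> {0..T}"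
  shows "norm (f t - f 0) \<le> B * t"
proof -
  have "norm (f t - f 0) \<le> B * norm (t - 0)"
  proof (rule differentiable_bound[where f' = "\<lambda>t h. h *\<^sub>R f' t" and S = "{0..T}"])
    show "onorm (\<lambda>h. h *\<^sub>R f' x) \<le> B" if "x \<in> {0..T}" for x
      using B[OF that] by (intro onorm_le) (simp add: mult.commute[of B] mult_left_mono)
  qed (use f t in \<open>auto simp: has_vector_derivative_def\<close>)
  thus ?thesis using t by simp
qed

text \<open>An equation \<open>U' = G U\<close> with small \<open>G\<close>. Let \<open>M\<close> be the maximum of \<open>norm (U t)\<close> on
  \<open>{0..T}\<close>. The mean value inequality bounds \<open>U - mat 1\<close> by \<open>g * T * M \<le> M / 2\<close>, hence
  \<open>M \<le> 2 * norm (mat 1)\<close> and no exponential estimate is needed. Then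
  \<open>G U - H = (G - H) + G (U - mat 1)\<close> is the derivative of \<open>U - W\<close>, and its second summand is
  quadratic in \<open>g\<close>.\<close>

lemma near_identity_solution:
  fixes U W G H :: "real \<Rightarrow> complex ^ 'n ^ 'n"
  assumes T: "T > 0"
    and U: "\<And>t. t \<in> {0..T} \<Longrightarrow> (U has_vector_derivative G t ** U t) (at t within {0..T})"
    and W: "\<And>t. t \<in> {0..T} \<Longrightarrow> (W has_vector_derivative H t) (at t within {0..T})"
    and init: "U 0 = mat 1" "W 0 = 0"
    and G: "\<And>t. t \<in> {0..T} \<Longrightarrow> norm (G t) \<le> g" and small: "g * T \<le> 1 / 2"
    and H: "\<And>t. t \<in> {0..T} \<Longrightarrow> norm (G t - H t) \<le> h"
  shows "norm (U T - mat 1 - W T) \<le> (h + 2 * g\<^sup>2 * T * norm (mat 1 :: complex ^ 'n ^ 'n)) * T"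
proof -
  let ?N = "norm (mat 1 :: complex ^ 'n ^ 'n)"
  have g: "g \<ge> 0" using G[of 0] T by (auto intro: order_trans[OF norm_ge_zero])
  have "continuous_on {0..T} U"
    using U has_vector_derivative_continuous by (fastforce simp: continuous_on_eq_continuous_within)
  hence "continuous_on {0..T} (\<lambda>t. norm (U t))" by (intro continuous_intros)
  then obtain s where s: "s \<in> {0..T}" "\<And>t. t \<in> {0..T} \<Longrightarrow> norm (U t) \<le> norm (U s)"
    using continuous_attains_sup[of "{0..T}" "\<lambda>t. norm (U t)"] T by auto
  have GU: "norm (G t ** U t) \<le> g * norm (U s)" if "t \<in> {0..T}" for t
    using norm_matrix_mult_le[of "G t" "U t"] mult_mono[OF G[OF that] s(2)[OF that] g]
    by auto
  have dev: "norm (U t - mat 1) \<le> g * T * norm (U s)" if t: "t \<in> {0..T}" for t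
  proof -
    have "norm (U t - U 0) \<le> g * norm (U s) * t"
      by (rule vector_derivative_bound[OF U GU t])
    also have "\<dots> \<le> g * norm (U s) * T"
      using t g by (intro mult_left_mono) auto
    finally show ?thesis by (simp add: init mult_ac)
  qed
  have "norm (U s) \<le> norm (U s - mat 1) + ?N"
    using norm_triangle_ineq[of "U s - mat 1" "mat 1"] by simp
  also have "\<dots> \<le> 1 / 2 * norm (U s) + ?N"
    using dev[OF s(1)] small mult_right_mono[OF small norm_ge_zero[of "U s"]] by linarith
  finally have Us: "norm (U s) \<le> 2 * ?N" by simp
  have dev': "norm (U t - mat 1) \<le> 2 * g * T * ?N" if t: "t \<in> {0..T}" for t
  proof -
    have "g * T * norm (U s) \<le> g * T * (2 * ?N)"
      using Us g T by (intro mult_left_mono) auto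
    thus ?thesis using dev[OF t] by simp
  qed
  interpret mm: bounded_bilinear "(**) :: complex ^ 'n ^ 'n \<Rightarrow> complex ^ 'n ^ 'n \<Rightarrow> complex ^ 'n ^ 'n"
    by (rule bounded_bilinear_matrix_mult)
  have "norm ((U T - W T) - (U 0 - W 0)) \<le> (h + 2 * g\<^sup>2 * T * ?N) * T"
  proof (rule vector_derivative_bound[where f' = "\<lambda>t. G t ** U t - H t" and T = T])
    show "((\<lambda>t. U t - W t) has_vector_derivative G t ** U t - H t) (at t within {0..T})"
      if "t \<in> {0..T}" for t
      using U[OF that] W[OF that] by (rule has_vector_derivative_diff)
    show "norm (G t ** U t - H t) \<le> h + 2 * g\<^sup>2 * T * ?N" if t: "t \<in> {0..T}" for t
    proof -
      have "G t ** U t - H t = (G t - H t) + G t ** (U t - mat 1)"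
        by (simp add: mm.diff_right)
      hence "norm (G t ** U t - H t) \<le> norm (G t - H t) + norm (G t ** (U t - mat 1))"
        using norm_triangle_ineq[of "G t - H t" "G t ** (U t - mat 1)"] by (simp only:)
      also have "norm (G t ** (U t - mat 1)) \<le> g * (2 * g * T * ?N)"
        using norm_matrix_mult_le[of "G t" "U t - mat 1"] mult_mono[OF G[OF t] dev'[OF t] g]
        by auto
      finally show ?thesis using H[OF t] by (simp add: power2_eq_square mult_ac)
    qed
  qed (use T in auto)
  thus ?thesis by (simp add: init algebra_simps)
qed

lemma continuous_on_interval_bounded:
  fixes f :: "real \<Rightarrow> 'a::real_normed_vector"
  assumes "continuous_on {a..b} f"
  obtains B where "B \<ge> 0" "\<And>t. t \<in> {a..b} \<Longrightarrow> norm (f t) \<le> B"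
proof -
  have "bounded (f ` {a..b})"
    by (intro compact_imp_bounded compact_continuous_image assms) simp
  thus ?thesis using that unfolding bounded_pos by (metis imageI less_imp_le)
qed

text \<open>The exponential of \<open>t\<close> times the diagonal matrix with entries \<open>a\<close>.\<close>

definition dexp :: "('n \<Rightarrow> complex) \<Rightarrow> real \<Rightarrow> complex ^ 'n ^ 'n" where
  "dexp a t = (\<chi> k l. if k = l then exp (of_real t * a k) else 0)"

lemma dexp_mult_nth:
  fixes M :: "complex ^ 'n ^ 'n"
  shows "(dexp a t ** M) $ k $ l = exp (of_real t * a k) * M $ k $ l"
    "(M ** dexp a t) $ k $ l = M $ k $ l * exp (of_real t * a l)"
  by (simp_all add: matrix_matrix_mult_def dexp_def if_distrib[where f = "\<lambda>x. x * _"]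
      if_distrib[where f = "\<lambda>x. _ * x"] cong: if_cong)

lemma exp_of_real_mult_has_vector_derivative:
  "((\<lambda>t. exp (of_real t * c)) has_vector_derivative c * exp (of_real t * c)) (at t within S)"
  for c :: complex
proof -
  have "((\<lambda>z. exp (z * c)) has_field_derivative c * exp (of_real t * c)) (at (of_real t))"
    by (auto intro!: derivative_eq_intros)
  thus ?thesis
    by (rule has_vector_derivative_at_within[OF has_vector_derivative_real_field])
qed

text \<open>First order perturbation theory in the interaction picture: \<open>U(t) = exp (- t A0) X(t)\<close> solves
  \<open>U' = G U\<close> with \<open>G = exp (- t A0) (A - A0) exp (t A0)\<close>, which is of size \<open>\<epsilon>\<close>. The entries
  of \<open>G\<close> are those of \<open>A - A0\<close> times the phases \<open>exp (t (a\<^sub>l - a\<^sub>k))\<close>; this is where the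
  integral \<open>I\<close> comes from.\<close>

lemma linear_ode_first_order:
  fixes A :: "complex \<Rightarrow> real \<Rightarrow> complex ^ 'n ^ 'n" and A1 :: "real \<Rightarrow> complex ^ 'n ^ 'n"
    and X :: "complex \<Rightarrow> real \<Rightarrow> complex ^ 'n ^ 'n" and A0 :: "complex ^ 'n ^ 'n"
  assumes T: "T > 0" and A0: "diagonal A0" and A1: "continuous_on {0..T} A1"
    and A: "\<forall>\<^sub>F \<epsilon> in at 0. \<forall>t\<in>{0..T}. norm (A \<epsilon> t - A0 - \<epsilon> *\<^sub>C A1 t) \<le> K * norm \<epsilon> ^ 2"
    and X: "\<forall>\<^sub>F \<epsilon> in at 0. X \<epsilon> 0 = mat 1 \<and>
              (\<forall>t. (X \<epsilon> has_vector_derivative A \<epsilon> t ** X \<epsilon> t) (at t))"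
    and I: "((\<lambda>t. exp (of_real t * (A0 $ l $ l - A0 $ k $ k)) * A1 t $ k $ l) has_integral I) {0..T}"
  shows "(\<lambda>\<epsilon>. X \<epsilon> T $ k $ l - exp (of_real T * A0 $ k $ k) * ((mat 1 :: complex ^ 'n ^ 'n) $ k $ l + \<epsilon> * I))
           \<in> O[at 0](\<lambda>\<epsilon>. \<epsilon> ^ 2)"
proof -
  let ?N = "norm (mat 1 :: complex ^ 'n ^ 'n)"
  define a where "a m = A0 $ m $ m" for m
  define conj where "conj M t = dexp (\<lambda>m. - a m) t ** M ** dexp a t" for M :: "complex ^ 'n ^ 'n" and t
  have conj_nth: "conj M t $ p $ q = exp (of_real t * (a q - a p)) * M $ p $ q" for M t p q
    by (simp add: conj_def dexp_mult_nth exp_diff exp_minus right_diff_distrib field_simps)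
  have "continuous_on {0..T} (\<lambda>t. \<Sum>p\<in>UNIV. \<Sum>q\<in>UNIV. norm (exp (of_real t * (a q - a p))))"
    by (intro continuous_intros)
  then obtain C where C0: "C \<ge> 0" and C: "\<And>t. t \<in> {0..T} \<Longrightarrow>
      norm (\<Sum>p\<in>UNIV. \<Sum>q\<in>UNIV. norm (exp (of_real t * (a q - a p)))) \<le> C"
    by (rule continuous_on_interval_bounded) blast
  have norm_conj: "norm (conj M t) \<le> C * norm M" if t: "t \<in> {0..T}" for M t
  proof (rule norm_matrix_le_entries)
    fix p q
    have "norm (exp (of_real t * (a q - a p))) \<le> (\<Sum>q\<in>UNIV. norm (exp (of_real t * (a q - a p))))"
      by (rule member_le_sum) auto
    also have "\<dots> \<le> (\<Sum>p\<in>UNIV. \<Sum>q\<in>UNIV. norm (exp (of_real t * (a q - a p))))"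
      by (rule member_le_sum[of p _ "\<lambda>p. \<Sum>q\<in>UNIV. norm (exp (of_real t * (a q - a p)))"]) (auto simp: sum_nonneg)
    also have "\<dots> \<le> C" using C[OF t] unfolding real_norm_def by (rule order_trans[OF abs_ge_self])
    finally show "norm (conj M t $ p $ q) \<le> C * norm (M $ p $ q)"
      unfolding conj_nth norm_mult by (rule mult_right_mono) simp
  qed (rule C0)
  obtain K1 where K1: "K1 \<ge> 0" and t1: "\<And>t. t \<in> {0..T} \<Longrightarrow> norm (A1 t) \<le> K1"
    using A1 by (rule continuous_on_interval_bounded) blast
  define W where "W t = integral {0..t} (\<lambda>t. conj (A1 t) t)" for t
  have cont: "continuous_on {0..T} (\<lambda>t. conj (A1 t) t)"
  proof -
    have "continuous_on {0..T} (\<lambda>t. \<chi> p q. exp (of_real t * (a q - a p)) * A1 t $ p $ q)"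
      by (intro continuous_intros A1)
    also have "(\<lambda>t. \<chi> p q. exp (of_real t * (a q - a p)) * A1 t $ p $ q) = (\<lambda>t. conj (A1 t) t)"
      by (simp add: fun_eq_iff vec_eq_iff conj_nth)
    finally show ?thesis .
  qed
  have W': "(W has_vector_derivative conj (A1 t) t) (at t within {0..T})" if "t \<in> {0..T}" for t
    unfolding W_def by (rule integral_has_vector_derivative[OF cont that])
  have W0: "W 0 = 0" by (simp add: W_def)
  have WT: "W T $ k $ l = I"
  proof -
    have "((\<lambda>t. conj (A1 t) t) has_integral W T) {0..T}"
      unfolding W_def using cont by (intro integrable_integral integrable_continuous_real)
    hence "((\<lambda>t. conj (A1 t) t $ k $ l) has_integral W T $ k $ l) {0..T}"
      using has_integral_linear[OF has_integral_linear[OF _ bounded_linear_vec_nth[of k]] bounded_linear_vec_nth[of l]]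
      by (simp add: o_def)
    with I show ?thesis
      by (simp add: conj_nth a_def has_integral_unique)
  qed
  interpret mm: bounded_bilinear "(**) :: complex ^ 'n ^ 'n \<Rightarrow> complex ^ 'n ^ 'n \<Rightarrow> complex ^ 'n ^ 'n"
    by (rule bounded_bilinear_matrix_mult)
  \<comment> \<open>The absolute value is taken because \<open>K\<close> may be negative.\<close>
  define K2 where "K2 = K1 + \<bar>K\<bar>"
  have K2: "K2 \<ge> 0" using K1 by (simp add: K2_def)
  define B where "B = (C * \<bar>K\<bar> + 2 * (C * K2)\<^sup>2 * T * ?N) * T"
  have small: "\<forall>\<^sub>F \<epsilon> in at (0::complex). norm \<epsilon> < 1 \<and> norm \<epsilon> * (C * K2 * T) \<le> 1 / 2"
  proof -
    have "((\<lambda>\<epsilon>::complex. norm \<epsilon> * (C * K2 * T)) \<longlongrightarrow> norm (0::complex) * (C * K2 * T)) (at 0)"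
      by (intro tendsto_intros)
    hence "\<forall>\<^sub>F \<epsilon> in at 0. norm (\<epsilon>::complex) * (C * K2 * T) < 1 / 2"
      by (rule order_tendstoD) simp
    moreover have "\<forall>\<^sub>F \<epsilon> in at 0. norm (\<epsilon>::complex) < 1"
      using order_tendstoD(2)[OF tendsto_norm_zero[OF tendsto_ident_at], of 1] by auto
    ultimately show ?thesis by eventually_elim auto
  qed
  have main: "norm (X \<epsilon> T $ k $ l - exp (of_real T * a k) * ((mat 1 :: complex ^ 'n ^ 'n) $ k $ l + \<epsilon> * I))
      \<le> norm (exp (of_real T * a k)) * B * norm (\<epsilon> ^ 2)"
    if A: "\<forall>t\<in>{0..T}. norm (A \<epsilon> t - A0 - \<epsilon> *\<^sub>C A1 t) \<le> K * norm \<epsilon> ^ 2"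
      and X: "X \<epsilon> 0 = mat 1 \<and> (\<forall>t. (X \<epsilon> has_vector_derivative A \<epsilon> t ** X \<epsilon> t) (at t))"
      and small: "norm \<epsilon> < 1 \<and> norm \<epsilon> * (C * K2 * T) \<le> 1 / 2" for \<epsilon>
  proof -
    define U where "U t = dexp (\<lambda>m. - a m) t ** X \<epsilon> t" for t
    define G where "G t = conj (A \<epsilon> t - A0) t" for t
    define H where "H t = \<epsilon> *\<^sub>C conj (A1 t) t" for t
    have U_nth: "U t $ p $ q = exp (- (of_real t * a p)) * X \<epsilon> t $ p $ q" for t p q
      by (simp add: U_def dexp_mult_nth)
    have GU: "(G t ** U t) $ p $ q = exp (- (of_real t * a p)) * ((A \<epsilon> t ** X \<epsilon> t) $ p $ q - a p * X \<epsilon> t $ p $ q)"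
      for t p q
    proof -
      have "G t ** U t = dexp (\<lambda>m. - a m) t ** ((A \<epsilon> t - A0) ** (dexp a t ** dexp (\<lambda>m. - a m) t) ** X \<epsilon> t)"
        by (simp add: G_def U_def conj_def matrix_mul_assoc)
      also have "dexp a t ** dexp (\<lambda>m. - a m) t = mat 1"
        by (simp add: vec_eq_iff dexp_mult_nth) (simp add: dexp_def mat_def exp_minus)
      finally have "(G t ** U t) $ p $ q = exp (- (of_real t * a p)) * ((A \<epsilon> t ** X \<epsilon> t) $ p $ q - (A0 ** X \<epsilon> t) $ p $ q)"
        by (simp add: dexp_mult_nth mm.diff_left)
      also have "(A0 ** X \<epsilon> t) $ p $ q = (\<Sum>m\<in>UNIV. if m = p then a p * X \<epsilon> t $ p $ q else 0)"
      proof -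
        have "A0 $ p $ m * X \<epsilon> t $ m $ q = (if m = p then a p * X \<epsilon> t $ p $ q else 0)" for m
          using A0 by (auto simp: diagonal_def a_def)
        thus ?thesis by (simp add: matrix_matrix_mult_def)
      qed
      finally show ?thesis by simp
    qed
    have "norm (U T - mat 1 - \<epsilon> *\<^sub>C W T) \<le>
        (C * \<bar>K\<bar> * norm \<epsilon> ^ 2 + 2 * (C * K2 * norm \<epsilon>)\<^sup>2 * T * ?N) * T"
    proof (rule near_identity_solution[where G = G and H = H])
      fix t assume t: "t \<in> {0..T}"
      show "(U has_vector_derivative G t ** U t) (at t within {0..T})"
      proof (rule has_vector_derivative_matrixI)
        fix p q
        have "((\<lambda>t. exp (of_real t * - a p) * X \<epsilon> t $ p $ q) has_vector_derivative
            exp (of_real t * - a p) * (A \<epsilon> t ** X \<epsilon> t) $ p $ q + (- a p * exp (of_real t * - a p)) * X \<epsilon> t $ p $ q)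
            (at t within {0..T})"
        proof (rule has_vector_derivative_mult[OF exp_of_real_mult_has_vector_derivative])
          have "(X \<epsilon> has_vector_derivative A \<epsilon> t ** X \<epsilon> t) (at t within {0..T})"
            using X has_vector_derivative_at_within by blast
          thus "((\<lambda>t. X \<epsilon> t $ p $ q) has_vector_derivative (A \<epsilon> t ** X \<epsilon> t) $ p $ q)
              (at t within {0..T})"
            by (intro bounded_linear.has_vector_derivative[OF bounded_linear_vec_nth])
        qed
        thus "((\<lambda>t. U t $ p $ q) has_vector_derivative (G t ** U t) $ p $ q) (at t within {0..T})"
          unfolding U_nth GU by (simp add: algebra_simps)
      qed
      show "((\<lambda>t. \<epsilon> *\<^sub>C W t) has_vector_derivative H t) (at t within {0..T})"
      proof (rule has_vector_derivative_matrixI)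
        fix p q
        show "((\<lambda>t. (\<epsilon> *\<^sub>C W t) $ p $ q) has_vector_derivative H t $ p $ q) (at t within {0..T})"
          unfolding H_def cscale_nth
          by (intro has_vector_derivative_mult_right bounded_linear.has_vector_derivative[OF bounded_linear_vec_nth] W'[OF t])
      qed
      have "G t - H t = conj (A \<epsilon> t - A0 - \<epsilon> *\<^sub>C A1 t) t"
        by (simp add: G_def H_def vec_eq_iff conj_nth algebra_simps)
      hence "norm (G t - H t) \<le> C * (norm (A \<epsilon> t - A0 - \<epsilon> *\<^sub>C A1 t))"
        by (simp add: norm_conj[OF t])
      also have "norm (A \<epsilon> t - A0 - \<epsilon> *\<^sub>C A1 t) \<le> \<bar>K\<bar> * norm \<epsilon> ^ 2"
        using A t by (meson abs_ge_self mult_right_mono order_trans zero_le_power2)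
      finally show "norm (G t - H t) \<le> C * \<bar>K\<bar> * norm \<epsilon> ^ 2"
        using C0 by (simp add: mult_left_mono)
      have "norm (A \<epsilon> t - A0) \<le> norm (A \<epsilon> t - A0 - \<epsilon> *\<^sub>C A1 t) + norm (\<epsilon> *\<^sub>C A1 t)"
        using norm_triangle_ineq[of "A \<epsilon> t - A0 - \<epsilon> *\<^sub>C A1 t" "\<epsilon> *\<^sub>C A1 t"] by simp
      also have "norm (A \<epsilon> t - A0 - \<epsilon> *\<^sub>C A1 t) \<le> \<bar>K\<bar> * norm \<epsilon> ^ 2" by fact
      also have "\<bar>K\<bar> * norm \<epsilon> ^ 2 \<le> \<bar>K\<bar> * norm \<epsilon>"
        using small by (intro mult_left_mono) (auto simp: power2_eq_square mult_left_le)
      also have "norm (\<epsilon> *\<^sub>C A1 t) \<le> norm \<epsilon> * K1"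
        using t1[OF t] by (simp add: norm_cscale mult_left_mono)
      also have "\<bar>K\<bar> * norm \<epsilon> + norm \<epsilon> * K1 = K2 * norm \<epsilon>" by (simp add: K2_def algebra_simps)
      finally have le: "norm (A \<epsilon> t - A0) \<le> K2 * norm \<epsilon>" by simp
      have "norm (G t) \<le> C * norm (A \<epsilon> t - A0)" unfolding G_def by (rule norm_conj[OF t])
      also have "\<dots> \<le> C * (K2 * norm \<epsilon>)" using le C0 by (rule mult_left_mono)
      finally show "norm (G t) \<le> C * K2 * norm \<epsilon>" by simp
    next
      show "U 0 = mat 1" using X by (simp add: vec_eq_iff U_nth)
      show "\<epsilon> *\<^sub>C W 0 = 0" by (simp add: vec_eq_iff W0)
      show "C * K2 * norm \<epsilon> * T \<le> 1 / 2" using small by (simp add: mult_ac)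
    qed (rule T)
    also have "\<dots> = B * norm \<epsilon> ^ 2" by (simp add: B_def power_mult_distrib algebra_simps)
    finally have *: "norm ((U T - mat 1 - \<epsilon> *\<^sub>C W T) $ k $ l) \<le> B * norm \<epsilon> ^ 2"
      using norm_matrix_nth_le order_trans by blast
    have "X \<epsilon> T $ k $ l - exp (of_real T * a k) * ((mat 1 :: complex ^ 'n ^ 'n) $ k $ l + \<epsilon> * I)
        = exp (of_real T * a k) * (U T - mat 1 - \<epsilon> *\<^sub>C W T) $ k $ l"
      by (simp add: U_nth WT exp_minus algebra_simps)
    thus ?thesis using mult_left_mono[OF *, of "norm (exp (of_real T * a k))"]
      by (simp add: norm_mult norm_power mult_ac)
  qed
  have "\<forall>\<^sub>F \<epsilon> in at 0. norm (X \<epsilon> T $ k $ l - exp (of_real T * a k) * ((mat 1 :: complex ^ 'n ^ 'n) $ k $ l + \<epsilon> * I))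
      \<le> norm (exp (of_real T * a k)) * B * norm (\<epsilon> ^ 2)"
    using A X small by eventually_elim (rule main)
  thus ?thesis unfolding a_def by (rule bigoI)
qed

section \<open>The first order coefficient of the Floquet matrix\<close>

text \<open>All but finitely many terms are differences of partial sums that are within distance 1 of the
  limit, uniformly in time; the others are bounded one by one.\<close>

lemma uniformly_convergent_series_terms_bounded:
  fixes a :: "nat \<Rightarrow> real \<Rightarrow> complex ^ 'm ^ 'n"
  assumes conv: "uniform_limit UNIV (\<lambda>M t. \<Sum>k<M. of_real \<rho> ^ k *\<^sub>C a k t) S sequentially"
    and bounded: "\<And>k. \<exists>B. \<forall>t. norm (a k t) \<le> B" and "\<rho> > 0"
  shows "\<exists>K. \<forall>k t. norm (a k t) * \<rho> ^ k \<le> K"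
proof -
  have "\<forall>\<^sub>F M in sequentially. \<forall>t\<in>UNIV. dist (\<Sum>k<M. of_real \<rho> ^ k *\<^sub>C a k t) (S t) < 1"
    using conv by (rule uniform_limitD) simp
  then obtain M where M: "\<And>m t. m \<ge> M \<Longrightarrow> dist (\<Sum>k<m. of_real \<rho> ^ k *\<^sub>C a k t) (S t) < 1"
    unfolding eventually_sequentially by blast
  obtain B where B: "\<And>k t. norm (a k t) \<le> B k"
    using bounded by metis
  have nrm: "norm (of_real \<rho> ^ k *\<^sub>C a k t) = norm (a k t) * \<rho> ^ k" for k t
    using \<open>\<rho> > 0\<close> by (simp add: norm_cscale norm_power)
  have "norm (a k t) * \<rho> ^ k \<le> 2 + (\<Sum>k<M. B k * \<rho> ^ k)" for k t
  proof (cases "k < M")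
    case True
    have B0: "B k * \<rho> ^ k \<ge> 0" for k
      using order_trans[OF norm_ge_zero B[of k 0]] \<open>\<rho> > 0\<close> by simp
    have "norm (a k t) * \<rho> ^ k \<le> B k * \<rho> ^ k"
      using B \<open>\<rho> > 0\<close> by (intro mult_right_mono) auto
    also have "\<dots> \<le> (\<Sum>k<M. B k * \<rho> ^ k)"
      using True B0 by (intro member_le_sum) auto
    finally show ?thesis by simp
  next
    case False
    have B0: "B k * \<rho> ^ k \<ge> 0" for k
      using order_trans[OF norm_ge_zero B[of k 0]] \<open>\<rho> > 0\<close> by simp
    let ?S = "\<lambda>m. \<Sum>k<m. of_real \<rho> ^ k *\<^sub>C a k t"
    have "of_real \<rho> ^ k *\<^sub>C a k t = ?S (Suc k) - ?S k" by simp
    hence "norm (a k t) * \<rho> ^ k = dist (?S (Suc k)) (?S k)"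
      by (simp add: dist_norm flip: nrm)
    also have "\<dots> \<le> dist (?S (Suc k)) (S t) + dist (?S k) (S t)"
      by (rule dist_triangle2)
    also have "\<dots> \<le> 2"
      using M[of "Suc k" t] M[of k t] False by simp
    finally show ?thesis using B0 by (simp add: sum_nonneg add_increasing2)
  qed
  thus ?thesis by blast
qed

lemma convergent_series_terms_bounded:
  fixes a :: "nat \<Rightarrow> complex ^ 'm ^ 'n"
  assumes "summable (\<lambda>k. of_real \<rho> ^ k *\<^sub>C a k)" "\<rho> > 0"
  shows "\<exists>K. \<forall>k. norm (a k) * \<rho> ^ k \<le> K"
proof -
  have "Bseq (\<lambda>k. of_real \<rho> ^ k *\<^sub>C a k)"
    by (rule convergent_imp_Bseq[OF convergentI[OF summable_LIMSEQ_zero[OF assms(1)]]])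
  then obtain K where "\<And>k. norm (of_real \<rho> ^ k *\<^sub>C a k) \<le> K"
    unfolding Bseq_def by blast
  thus ?thesis
    using \<open>\<rho> > 0\<close> by (intro exI[of _ K]) (simp add: norm_cscale norm_power mult.commute)
qed

lemma eventually_norm_less_at_0: "d > 0 \<Longrightarrow> \<forall>\<^sub>F \<epsilon> in at (0::complex). norm \<epsilon> < d"
  using order_tendstoD(2)[OF tendsto_norm_zero[OF tendsto_ident_at], of d] by auto

lemma power_series_first_order:
  fixes a :: "nat \<Rightarrow> complex ^ 'm ^ 'n"
  assumes "r > 0" and S: "\<And>\<epsilon>. norm \<epsilon> < r \<Longrightarrow> (\<lambda>k. \<epsilon> ^ k *\<^sub>C a k) sums S \<epsilon>"
  shows "\<exists>K. \<forall>\<^sub>F \<epsilon> in at 0. norm (S \<epsilon> - a 0 - \<epsilon> *\<^sub>C a 1) \<le> K * norm \<epsilon> ^ 2"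
proof -
  have "norm (of_real (r / 2) :: complex) < r" using \<open>r > 0\<close> by simp
  from sums_summable[OF S[OF this]]
  obtain K where K: "\<And>k. norm (a k) * (r / 2) ^ k \<le> K"
    using convergent_series_terms_bounded[of "r / 2" a] \<open>r > 0\<close> by auto
  have "\<forall>\<^sub>F \<epsilon> in at 0. norm (S \<epsilon> - a 0 - \<epsilon> *\<^sub>C a 1) \<le> 2 * K / (r / 2)\<^sup>2 * norm \<epsilon> ^ 2"
    using eventually_norm_less_at_0[OF \<open>r > 0\<close>] eventually_norm_less_at_0[OF half_gt_zero[OF half_gt_zero[OF \<open>r > 0\<close>]]]
    by eventually_elim (rule power_series_remainder, use \<open>r > 0\<close> in \<open>simp_all add: K S\<close>)
  thus ?thesis by blast
qed

lemma fourier_mode_has_integral: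
  fixes T :: real
  assumes "T > 0"
  shows "((\<lambda>t. exp (of_real t * (2 * of_real pi * \<i> * of_int m / of_real T))) has_integral
           (if m = 0 then of_real T else 0)) {0..T}"
proof (cases "m = 0")
  case True
  thus ?thesis
    using has_integral_const_real[of "1::complex" 0 T] assms by (simp add: scaleR_conv_of_real)
next
  case False
  define c where "c = 2 * of_real pi * \<i> * of_int m / of_real T"
  have c: "c \<noteq> 0" "of_real T * c = 2 * of_real pi * \<i> * of_int m"
    using False assms by (simp_all add: c_def)
  have one: "exp (of_real T * c) = 1"
    unfolding c(2) exp_eq_1 using c(2) by (intro conjI exI[of _ m]) auto
  have "((\<lambda>t. exp (of_real t * c)) has_integral
      exp (of_real T * c) / c - exp (of_real 0 * c) / c) {0..T}"
  proof (rule fundamental_theorem_of_calculus)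
    fix t assume "t \<in> {0..T}"
    have "((\<lambda>t. exp (of_real t * c) * (1 / c)) has_vector_derivative
        (c * exp (of_real t * c)) * (1 / c)) (at t within {0..T})"
      by (intro has_vector_derivative_mult_left exp_of_real_mult_has_vector_derivative)
    thus "((\<lambda>t. exp (of_real t * c) / c) has_vector_derivative exp (of_real t * c)) (at t within {0..T})"
      using c by simp
  qed (use assms in simp)
  thus ?thesis using False one by (simp add: c_def)
qed

text \<open>Allows comparing the coefficients of \<open>\<epsilon>\<close> in two expansions up to \<open>O(\<epsilon>\<^sup>2)\<close>.\<close>

lemma linear_in_bigo_square:
  fixes d :: complex
  assumes "(\<lambda>\<epsilon>. d * \<epsilon>) \<in> O[at 0](\<lambda>\<epsilon>. \<epsilon> ^ 2)"
  shows "d = 0"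
proof -
  obtain c where c: "\<forall>\<^sub>F \<epsilon> in at 0. norm (d * \<epsilon>) \<le> c * norm (\<epsilon> ^ 2)"
    using assms by (elim landau_o.bigE)
  have "\<forall>\<^sub>F \<epsilon> in at 0. norm d \<le> c * norm (\<epsilon>::complex)"
    using c eventually_neq_at_within[of 0]
    by eventually_elim (auto simp: norm_mult norm_power power2_eq_square)
  moreover have "((\<lambda>\<epsilon>::complex. c * norm \<epsilon>) \<longlongrightarrow> c * norm (0::complex)) (at 0)"
    by (rule tendsto_mult[OF tendsto_const tendsto_norm[OF tendsto_ident_at]])
  ultimately have "norm d \<le> c * norm (0::complex)"
    by (intro tendsto_lowerbound[OF _ _ trivial_limit_at])
  thus ?thesis by simp
qed

lemma continuous_on_cscale:
  assumes "continuous_on S c"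
  shows "continuous_on S (\<lambda>t. c t *\<^sub>C M)"
proof -
  have "continuous_on S (\<lambda>t. \<chi> k l. c t * M $ k $ l)"
    by (intro continuous_intros assms)
  thus ?thesis by (simp add: cscale_def map_matrix_def)
qed

text \<open>Both sides of \<open>X \<epsilon> T = mexp (T *\<^sub>R F \<epsilon>)\<close> are expanded to first order. The zeroth order
  terms agree because \<open>T * A0 $ k $ k\<close> and \<open>T * Fc 0 $ k $ k\<close> differ by the multiple \<open>n k\<close>
  of \<open>2\<pi>i\<close>. As the entries \<open>k\<close> and \<open>l\<close> of \<open>Fc 0\<close> coincide, the constant equation
  carries no phase and contributes \<open>T * Fc 1 $ k $ l\<close>, while the phase in the periodic equation
  shifts every Fourier mode of \<open>Ac 1\<close> by \<open>n l - n k\<close>.\<close>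

lemma first_order_floquet_entry:
  fixes T r0 r :: real
    and A X :: "complex \<Rightarrow> real \<Rightarrow> complex ^ 'n ^ 'n"
    and Ac :: "nat \<Rightarrow> real \<Rightarrow> complex ^ 'n ^ 'n"
    and Ahat :: "nat \<Rightarrow> int \<Rightarrow> complex ^ 'n ^ 'n"
    and A0 :: "complex ^ 'n ^ 'n"
    and F :: "complex \<Rightarrow> complex ^ 'n ^ 'n"
    and Fc :: "nat \<Rightarrow> complex ^ 'n ^ 'n"
    and n :: "'n \<Rightarrow> int"
  assumes "T > 0" and "r0 > 0"
    and A_series: "\<And>\<epsilon>. norm \<epsilon> < r0 \<Longrightarrow>
          uniform_limit UNIV (\<lambda>M t. \<Sum>k<M. \<epsilon> ^ k *\<^sub>C Ac k t) (A \<epsilon>) sequentially"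
    and A0_diagonal: "diagonal A0"
    and A0_constant: "\<And>t. Ac 0 t = A0"
    and Fourier_finite: "\<And>k. k \<ge> 1 \<Longrightarrow> finite {m. Ahat k m \<noteq> 0}"
    and Fourier: "\<And>k t. k \<ge> 1 \<Longrightarrow>
          Ac k t = (\<Sum>m | Ahat k m \<noteq> 0. exp (2 * pi * \<i> * of_int m * t / T) *\<^sub>C Ahat k m)"
    and F0_diagonal: "diagonal (Fc 0)"
    and folding_number: "\<And>k. of_int (n k) = T / (2 * pi * \<i>) * (A0 - Fc 0) $ k $ k"
    and "0 < r"
    and X_solution: "\<And>\<epsilon> t. norm \<epsilon> < r \<Longrightarrow> (X \<epsilon> has_vector_derivative A \<epsilon> t ** X \<epsilon> t) (at t)"
    and X_initial: "\<And>\<epsilon>. norm \<epsilon> < r \<Longrightarrow> X \<epsilon> 0 = mat 1"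
    and monodromy: "\<And>\<epsilon>. norm \<epsilon> < r \<Longrightarrow> X \<epsilon> T = mexp (T *\<^sub>R F \<epsilon>)"
    and F_series: "\<And>\<epsilon>. norm \<epsilon> < r \<Longrightarrow> (\<lambda>k. \<epsilon> ^ k *\<^sub>C Fc k) sums F \<epsilon>"
    and same: "Fc 0 $ k $ k = Fc 0 $ l $ l"
  shows "Fc 1 $ k $ l = Ahat 1 (n k - n l) $ k $ l"
proof -
  define fs where "fs = {m. Ahat 1 m \<noteq> 0}"
  have fin: "finite fs" using Fourier_finite[of 1] by (simp add: fs_def)
  have A1: "Ac 1 t = (\<Sum>m\<in>fs. exp (of_real t * (2 * of_real pi * \<i> * of_int m / of_real T)) *\<^sub>C Ahat 1 m)" for t
    using Fourier[of 1 t] by (simp add: fs_def mult_ac)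
  have A1_cont: "continuous_on {0..T} (Ac 1)"
    unfolding A1 by (intro continuous_intros continuous_on_cscale)
  have bounded: "\<exists>B. \<forall>t. norm (Ac q t) \<le> B" for q
  proof (cases "q = 0")
    case True
    thus ?thesis using A0_constant by auto
  next
    case False
    have "norm (Ac q t) \<le> (\<Sum>m | Ahat q m \<noteq> 0. norm (Ahat q m))" for t
    proof -
      have "norm (exp (2 * pi * \<i> * of_int m * t / T)) = 1" for m
        by simp
      thus ?thesis
        using False by (simp add: Fourier sum_norm_le norm_cscale)
    qed
    thus ?thesis by blast
  qed
  define \<rho> where "\<rho> = r0 / 2"
  have \<rho>: "\<rho> > 0" "norm (of_real \<rho> :: complex) < r0" using \<open>r0 > 0\<close> by (auto simp: \<rho>_def)
  obtain K where K: "\<And>q t. norm (Ac q t) * \<rho> ^ q \<le> K"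
    using uniformly_convergent_series_terms_bounded[OF A_series[OF \<rho>(2)] bounded \<rho>(1)] by blast
  have A_rem: "\<forall>\<^sub>F \<epsilon> in at 0. \<forall>t\<in>{0..T}. norm (A \<epsilon> t - A0 - \<epsilon> *\<^sub>C Ac 1 t) \<le> (2 * K / \<rho>\<^sup>2) * norm \<epsilon> ^ 2"
    using eventually_norm_less_at_0[OF \<open>r0 > 0\<close>] eventually_norm_less_at_0[OF half_gt_zero[OF \<rho>(1)]]
  proof eventually_elim
    case (elim \<epsilon>)
    show ?case
    proof
      fix t
      have "(\<lambda>q. \<epsilon> ^ q *\<^sub>C Ac q t) sums A \<epsilon> t"
        using tendsto_uniform_limitI[OF A_series[OF elim(1)], of t] by (simp add: sums_def)
      thus "norm (A \<epsilon> t - A0 - \<epsilon> *\<^sub>C Ac 1 t) \<le> (2 * K / \<rho>\<^sup>2) * norm \<epsilon> ^ 2"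
        using power_series_remainder[of "\<lambda>q. Ac q t" \<rho> K \<epsilon> "A \<epsilon> t"] K \<rho> elim(2) A0_constant by simp
    qed
  qed
  obtain K' where F_rem: "\<forall>\<^sub>F \<epsilon> in at 0. norm (F \<epsilon> - Fc 0 - \<epsilon> *\<^sub>C Fc 1) \<le> K' * norm \<epsilon> ^ 2"
    using power_series_first_order[OF \<open>r > 0\<close> F_series] by blast
  have a_eq: "A0 $ p $ p = Fc 0 $ p $ p + 2 * of_real pi * \<i> * of_int (n p) / of_real T" for p
    using folding_number[of p] \<open>T > 0\<close> by (simp add: field_simps)
  have exps: "exp (of_real T * A0 $ k $ k) = exp (of_real T * Fc 0 $ k $ k)"
    unfolding exp_eq a_eq using \<open>T > 0\<close> by (intro exI[of _ "n k"]) (simp add: field_simps)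
  have "((\<lambda>t. \<Sum>m\<in>fs. exp (of_real t * (2 * of_real pi * \<i> * of_int (m - (n k - n l)) / of_real T)) * Ahat 1 m $ k $ l)
     has_integral (\<Sum>m\<in>fs. (if m - (n k - n l) = 0 then of_real T else 0) * Ahat 1 m $ k $ l)) {0..T}"
    by (intro has_integral_sum fin has_integral_mult_left fourier_mode_has_integral \<open>T > 0\<close>)
  also have "(\<lambda>t. \<Sum>m\<in>fs. exp (of_real t * (2 * of_real pi * \<i> * of_int (m - (n k - n l)) / of_real T)) * Ahat 1 m $ k $ l)
     = (\<lambda>t. exp (of_real t * (A0 $ l $ l - A0 $ k $ k)) * Ac 1 t $ k $ l)"
  proof
    fix t
    have mode: "exp (of_real t * (2 * of_real pi * \<i> * of_int (m - (n k - n l)) / of_real T))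
       = exp (of_real t * (A0 $ l $ l - A0 $ k $ k)) * exp (of_real t * (2 * of_real pi * \<i> * of_int m / of_real T))" for m
      unfolding exp_add[symmetric] a_eq same by (simp add: diff_divide_distrib algebra_simps add_divide_distrib)
    show "(\<Sum>m\<in>fs. exp (of_real t * (2 * of_real pi * \<i> * of_int (m - (n k - n l)) / of_real T)) * Ahat 1 m $ k $ l)
      = exp (of_real t * (A0 $ l $ l - A0 $ k $ k)) * Ac 1 t $ k $ l"
      unfolding A1 sum_component cscale_nth sum_distrib_left by (simp only: mode) (simp only: mult.assoc)
  qed
  also have "(\<Sum>m\<in>fs. (if m - (n k - n l) = 0 then of_real T else 0) * Ahat 1 m $ k $ l)
     = (\<Sum>m\<in>fs. if m = n k - n l then of_real T * Ahat 1 (n k - n l) $ k $ l else 0)"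
    by (intro sum.cong) auto
  also have "\<dots> = of_real T * Ahat 1 (n k - n l) $ k $ l"
    using fin by (auto simp: fs_def)
  finally have I_A: "((\<lambda>t. exp (of_real t * (A0 $ l $ l - A0 $ k $ k)) * Ac 1 t $ k $ l) has_integral
      of_real T * Ahat 1 (n k - n l) $ k $ l) {0..T}" .
  have I_F: "((\<lambda>t. exp (of_real t * (Fc 0 $ l $ l - Fc 0 $ k $ k)) * Fc 1 $ k $ l) has_integral
      of_real T * Fc 1 $ k $ l) {0..T}"
    using has_integral_const_real[of "Fc 1 $ k $ l" 0 T] \<open>T > 0\<close> by (simp add: same scaleR_conv_of_real)
  define \<delta> where "\<delta> = (mat 1 :: complex ^ 'n ^ 'n) $ k $ l"
  define e where "e = exp (of_real T * Fc 0 $ k $ k)"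
  have "(\<lambda>\<epsilon>. X \<epsilon> T $ k $ l - e * (\<delta> + \<epsilon> * (of_real T * Ahat 1 (n k - n l) $ k $ l))) \<in> O[at 0](\<lambda>\<epsilon>. \<epsilon> ^ 2)"
    unfolding e_def \<delta>_def exps[symmetric]
  proof (rule linear_ode_first_order[OF \<open>T > 0\<close> A0_diagonal A1_cont A_rem _ I_A])
    show "\<forall>\<^sub>F \<epsilon> in at 0. X \<epsilon> 0 = mat 1 \<and> (\<forall>t. (X \<epsilon> has_vector_derivative A \<epsilon> t ** X \<epsilon> t) (at t))"
      using eventually_norm_less_at_0[OF \<open>r > 0\<close>] by eventually_elim (auto simp: X_solution X_initial)
  qed
  moreover have "(\<lambda>\<epsilon>. mexp (T *\<^sub>R F \<epsilon>) $ k $ l - e * (\<delta> + \<epsilon> * (of_real T * Fc 1 $ k $ l))) \<in> O[at 0](\<lambda>\<epsilon>. \<epsilon> ^ 2)"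
    unfolding e_def \<delta>_def
    by (rule linear_ode_first_order[OF \<open>T > 0\<close> F0_diagonal, of "\<lambda>_. Fc 1" "\<lambda>\<epsilon> _. F \<epsilon>" K' "\<lambda>\<epsilon> t. mexp (t *\<^sub>R F \<epsilon>)"])
      (use F_rem I_F in \<open>auto simp: mexp_0 mexp_has_vector_derivative\<close>)
  ultimately have "(\<lambda>\<epsilon>. (X \<epsilon> T $ k $ l - e * (\<delta> + \<epsilon> * (of_real T * Ahat 1 (n k - n l) $ k $ l)))
      - (mexp (T *\<^sub>R F \<epsilon>) $ k $ l - e * (\<delta> + \<epsilon> * (of_real T * Fc 1 $ k $ l)))) \<in> O[at 0](\<lambda>\<epsilon>. \<epsilon> ^ 2)"
    by (rule sum_in_bigo)
  also have "?this \<longleftrightarrow> (\<lambda>\<epsilon>. e * of_real T * (Fc 1 $ k $ l - Ahat 1 (n k - n l) $ k $ l) * \<epsilon>) \<in> O[at 0](\<lambda>\<epsilon>. \<epsilon> ^ 2)"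
  proof (rule landau_o.big.in_cong)
    show "\<forall>\<^sub>F \<epsilon> in at 0. (X \<epsilon> T $ k $ l - e * (\<delta> + \<epsilon> * (of_real T * Ahat 1 (n k - n l) $ k $ l)))
      - (mexp (T *\<^sub>R F \<epsilon>) $ k $ l - e * (\<delta> + \<epsilon> * (of_real T * Fc 1 $ k $ l)))
      = e * of_real T * (Fc 1 $ k $ l - Ahat 1 (n k - n l) $ k $ l) * \<epsilon>"
      using eventually_norm_less_at_0[OF \<open>r > 0\<close>] by eventually_elim (simp add: monodromy algebra_simps)
  qed
  finally have "e * of_real T * (Fc 1 $ k $ l - Ahat 1 (n k - n l) $ k $ l) = 0"
    by (rule linear_in_bigo_square)
  thus ?thesis using \<open>T > 0\<close> by (simp add: e_def)
qed

section \<open>Continuity of the roots of a polynomial\<close>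

lemma monic_poly_eq_prod_roots:
  fixes p :: "complex poly"
  assumes "lead_coeff p = 1"
  shows "poly p z = (\<Prod>x\<in>#proots p. z - x)"
proof -
  have "p = (\<Prod>x\<in>#proots p. [:-x, 1:])"
    using complex_poly_decompose_multiset[of p] assms by simp
  hence "poly p z = poly (\<Prod>x\<in>#proots p. [:-x, 1:]) z" by simp
  also have "\<dots> = (\<Prod>x\<in>#proots p. z - x)"
    by (simp add: poly_prod_mset image_mset.compositionality o_def)
  finally show ?thesis .
qed

lemma prod_mset_dist_ge_power:
  fixes Z :: "complex multiset"
  assumes "\<And>x. x \<in># Z \<Longrightarrow> d \<le> norm (c - x)" "d \<ge> 0"
  shows "d ^ size Z \<le> norm (\<Prod>x\<in>#Z. c - x)"
  using assms
proof (induction Z)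
  case (add x Z)
  thus ?case by (auto simp: norm_mult intro!: mult_mono)
qed simp

text \<open>The value of a monic polynomial at \<open>c\<close> is the product of the differences between \<open>c\<close> and the
  roots, so the root nearest to \<open>c\<close> is no farther than the geometric mean.\<close>

lemma monic_poly_root_near:
  fixes p :: "complex poly"
  assumes "lead_coeff p = 1" "degree p = Suc N"
  obtains z where "poly p z = 0" "norm (c - z) ^ Suc N \<le> norm (poly p c)"
proof -
  have sz: "size (proots p) = Suc N" using assms by (simp add: size_proots_complex)
  have p0: "p \<noteq> 0" using assms by auto
  define R where "R = (\<lambda>z. norm (c - z)) ` set_mset (proots p)"
  have R: "finite R" "R \<noteq> {}" using sz by (auto simp: R_def)
  have "Min R \<in> R" using R by (rule Min_in)
  then obtain z where z: "z \<in># proots p" "norm (c - z) = Min R" by (auto simp: R_def)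
  have le: "norm (c - z) ^ size (proots p) \<le> norm (\<Prod>x\<in>#proots p. c - x)"
    by (rule prod_mset_dist_ge_power) (use z R in \<open>auto simp: R_def\<close>)
  show ?thesis
  proof (rule that)
    show "poly p z = 0" using z(1) p0 by simp
    show "norm (c - z) ^ Suc N \<le> norm (poly p c)"
      using le unfolding sz monic_poly_eq_prod_roots[OF assms(1)] .
  qed
qed

lemma coeff_synthetic_div:
  fixes p :: "'a::comm_ring_1 poly"
  shows "coeff (synthetic_div p c) k = coeff p (Suc k) + c * coeff (synthetic_div p c) (Suc k)"
proof -
  have "coeff (p + smult c (synthetic_div p c)) (Suc k) = coeff (pCons (poly p c) (synthetic_div p c)) (Suc k)"
    by (simp only: synthetic_div_correct)
  thus ?thesis by simp
qed

text \<open>Division by a linear factor is continuous in the coefficients and in the root: the coefficients of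
  the quotient are determined recursively, starting from the leading one.\<close>

lemma tendsto_coeff_synthetic_div:
  fixes p :: "'b \<Rightarrow> complex poly"
  assumes p: "\<And>k. ((\<lambda>x. coeff (p x) k) \<longlongrightarrow> coeff p0 k) \<F>" and z: "(z \<longlongrightarrow> c) \<F>"
    and deg: "\<And>x. degree (p x) \<le> N" "degree p0 \<le> N"
  shows "((\<lambda>x. coeff (synthetic_div (p x) (z x)) k) \<longlongrightarrow> coeff (synthetic_div p0 c) k) \<F>"
proof (induction "N - k" arbitrary: k)
  case 0
  have "coeff (synthetic_div q y) k = 0" if "degree q \<le> N" for q and y :: complex
  proof (cases "degree q = 0")
    case True
    thus ?thesis by (simp add: synthetic_div_eq_0_iff[THEN iffD2])
  next
    case False
    thus ?thesis using 0 that by (intro coeff_eq_0) (simp add: degree_synthetic_div)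
  qed
  thus ?case using deg by simp
next
  case (Suc d)
  have IH: "((\<lambda>x. coeff (synthetic_div (p x) (z x)) (Suc k)) \<longlongrightarrow> coeff (synthetic_div p0 c) (Suc k)) \<F>"
    using Suc.hyps(2) by (intro Suc.hyps(1)) simp
  have "((\<lambda>x. coeff (p x) (Suc k) + z x * coeff (synthetic_div (p x) (z x)) (Suc k)) \<longlongrightarrow>
      coeff p0 (Suc k) + c * coeff (synthetic_div p0 c) (Suc k)) \<F>"
    by (intro tendsto_intros p z IH)
  thus ?case by (simp flip: coeff_synthetic_div)
qed

lemma poly_eq_sum_upto:
  fixes p :: "complex poly"
  assumes "degree p \<le> N"
  shows "poly p z = (\<Sum>k\<le>N. coeff p k * z ^ k)"
  unfolding poly_altdef using assms
  by (intro sum.mono_neutral_left) (auto simp: coeff_eq_0)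

lemma poly_diff_le:
  fixes p q :: "complex poly"
  assumes deg: "degree p \<le> N" "degree q \<le> N" and z: "norm z \<le> R"
  shows "norm (poly p z - poly q z) \<le> (\<Sum>k\<le>N. norm (coeff p k - coeff q k) * R ^ k)"
proof -
  have "poly p z - poly q z = (\<Sum>k\<le>N. (coeff p k - coeff q k) * z ^ k)"
    by (simp add: poly_eq_sum_upto[OF deg(1)] poly_eq_sum_upto[OF deg(2)] left_diff_distrib sum_subtractf)
  also have "norm \<dots> \<le> (\<Sum>k\<le>N. norm (coeff p k - coeff q k) * R ^ k)"
    using z by (intro sum_norm_le) (auto simp: norm_mult norm_power intro!: mult_left_mono power_mono)
  finally show ?thesis .
qed

text \<open>On the unit ball around \<open>c\<close>, convergence of the coefficients gives uniform convergence of the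
  values.\<close>

lemma no_roots_near_nonroot:
  fixes p :: "'b \<Rightarrow> complex poly"
  assumes p: "\<And>k. ((\<lambda>x. coeff (p x) k) \<longlongrightarrow> coeff p0 k) \<F>"
    and deg: "\<And>x. degree (p x) \<le> N" "degree p0 \<le> N" and nz: "poly p0 c \<noteq> 0"
  shows "\<exists>\<delta>>0. \<forall>\<^sub>F x in \<F>. \<forall>z. dist z c < \<delta> \<longrightarrow> poly (p x) z \<noteq> 0"
proof -
  define h where "h = norm (poly p0 c) / 2"
  have h: "h > 0" using nz by (simp add: h_def)
  have "isCont (poly p0) c" by simp
  then obtain \<delta>0 where \<delta>0: "\<delta>0 > 0" "\<And>z. dist z c < \<delta>0 \<Longrightarrow> dist (poly p0 z) (poly p0 c) < h"
    using h unfolding continuous_at_eps_delta by blast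
  define \<delta> where "\<delta> = min \<delta>0 1"
  have "((\<lambda>x. \<Sum>k\<le>N. norm (coeff (p x) k - coeff p0 k) * (norm c + 1) ^ k) \<longlongrightarrow>
      (\<Sum>k\<le>N. norm (coeff p0 k - coeff p0 k) * (norm c + 1) ^ k)) \<F>"
    by (intro tendsto_intros p)
  hence "\<forall>\<^sub>F x in \<F>. (\<Sum>k\<le>N. norm (coeff (p x) k - coeff p0 k) * (norm c + 1) ^ k) < h"
    by (rule order_tendstoD) (use h in simp)
  hence "\<forall>\<^sub>F x in \<F>. \<forall>z. dist z c < \<delta> \<longrightarrow> poly (p x) z \<noteq> 0"
  proof eventually_elim
    case (elim x)
    show ?case
    proof (intro allI impI notI)
      fix z assume z: "dist z c < \<delta>" and root: "poly (p x) z = 0"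
      have "norm z \<le> norm c + 1"
        using z norm_triangle_ineq2[of z c] by (simp add: \<delta>_def dist_norm)
      hence "norm (poly (p x) z - poly p0 z) < h"
        using poly_diff_le[OF deg(1) deg(2)] elim by (meson order.strict_trans1)
      moreover have "norm (poly p0 z - poly p0 c) < h"
        using \<delta>0(2)[of z] z by (simp add: \<delta>_def dist_norm)
      moreover have "norm (poly p0 c) \<le> norm (poly p0 z) + norm (poly p0 z - poly p0 c)"
        by (metis norm_minus_commute norm_triangle_sub)
      ultimately show False using root by (simp add: h_def)
    qed
  qed
  moreover have "\<delta> > 0" using \<delta>0 by (simp add: \<delta>_def)
  ultimately show ?thesis by blast
qed

lemma proots_eq_add_root:
  fixes p :: "complex poly"
  assumes "poly p z = 0" "p \<noteq> 0"
  shows "proots p = add_mset z (proots (synthetic_div p z))"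
proof -
  have eq: "p = [:-z, 1:] * synthetic_div p z"
    using synthetic_div_correct'[of z p] assms(1) by simp
  with assms(2) have "synthetic_div p z \<noteq> 0" by auto
  hence "proots ([:-z, 1:] * synthetic_div p z) = add_mset z (proots (synthetic_div p z))"
    by (subst proots_mult) auto
  thus ?thesis using eq by simp
qed

lemma monic_synthetic_div:
  fixes p :: "complex poly"
  assumes "degree p = Suc N" "lead_coeff p = 1"
  shows "degree (synthetic_div p z) = N" "lead_coeff (synthetic_div p z) = 1"
proof -
  show deg: "degree (synthetic_div p z) = N" using assms by (simp add: degree_synthetic_div)
  have "coeff (synthetic_div p z) (Suc N) = 0" using deg by (intro coeff_eq_0) simp
  thus "lead_coeff (synthetic_div p z) = 1"
    using assms deg coeff_synthetic_div[of p z N] by simp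
qed

text \<open>Induction on the multiplicity \<open>m\<close>. If \<open>c\<close> is a root of the limit, then the values at
  \<open>c\<close> tend to zero, so the polynomials have roots that tend to \<open>c\<close>. Dividing by the
  corresponding linear factors again gives convergent monic polynomials, whose limit has \<open>c\<close> as a
  root of multiplicity one less.\<close>

lemma number_of_roots_near:
  fixes p :: "'b \<Rightarrow> complex poly"
  assumes "\<And>k. ((\<lambda>x. coeff (p x) k) \<longlongrightarrow> coeff p0 k) \<F>"
    and "\<And>x. degree (p x) = N" "\<And>x. lead_coeff (p x) = 1" "degree p0 = N" "lead_coeff p0 = 1"
    and "count (proots p0) c = m"
  shows "\<exists>\<delta>>0. \<forall>\<^sub>F x in \<F>. size {#z \<in># proots (p x). dist z c < \<delta>#} = m"
  using assms
proof (induction m arbitrary: p p0 N)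
  case 0
  have nz: "poly p0 c \<noteq> 0" 
  proof -
    have "p0 \<noteq> 0" using 0(5) by auto
    thus ?thesis using 0(6) by (simp add: order_eq_0_iff)
  qed
  obtain \<delta> where \<delta>: "\<delta> > 0" "\<forall>\<^sub>F x in \<F>. \<forall>z. dist z c < \<delta> \<longrightarrow> poly (p x) z \<noteq> 0"
    using no_roots_near_nonroot[OF 0(1) _ _ nz, of N] 0(2,4) by auto
  have "\<forall>\<^sub>F x in \<F>. size {#z \<in># proots (p x). dist z c < \<delta>#} = 0"
    using \<delta>(2)
  proof eventually_elim
    case (elim x)
    have "p x \<noteq> 0" using 0(3)[of x] by auto
    thus ?case using elim by (auto simp: multiset_eq_iff order_0I)
  qed
  with \<delta>(1) show ?case by blast
next
  case (Suc m)
  have p0: "p0 \<noteq> 0" "p x \<noteq> 0" for x using Suc.prems(3)[of x] Suc.prems(5) by auto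
  have "c \<in># proots p0" using Suc.prems(6) by (metis count_eq_zero_iff nat.distinct(1))
  hence root: "poly p0 c = 0" using p0 by simp
  hence "degree p0 \<noteq> 0" using p0 by (metis degree_eq_zeroE mult_zero_right add_0_right poly_const_conv pCons_0_0 poly_0 poly_pCons)
  then obtain N' where N: "N = Suc N'" using Suc.prems(4) by (cases N) auto
  have "\<exists>z. poly (p x) z = 0 \<and> norm (c - z) ^ Suc N' \<le> norm (poly (p x) c)" for x
    using monic_poly_root_near[of "p x" N' c] Suc.prems(2,3) N by metis
  then obtain z where z: "\<And>x. poly (p x) (z x) = 0" "\<And>x. norm (c - z x) ^ Suc N' \<le> norm (poly (p x) c)"
    by metis
  have z_lim: "(z \<longlongrightarrow> c) \<F>"
  proof -
    have "((\<lambda>x. \<Sum>k\<le>N. coeff (p x) k * c ^ k) \<longlongrightarrow> (\<Sum>k\<le>N. coeff p0 k * c ^ k)) \<F>"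
      by (intro tendsto_intros Suc.prems(1))
    hence "((\<lambda>x. poly (p x) c) \<longlongrightarrow> 0) \<F>"
      using root Suc.prems(2,4) by (simp add: poly_eq_sum_upto[of _ N])
    hence "((\<lambda>x. norm (poly (p x) c)) \<longlongrightarrow> 0) \<F>" by (rule tendsto_norm_zero)
    hence "((\<lambda>x. root (Suc N') (norm (poly (p x) c))) \<longlongrightarrow> root (Suc N') 0) \<F>"
      by (rule tendsto_real_root)
    moreover have "norm (z x - c) \<le> root (Suc N') (norm (poly (p x) c))" for x
      using real_root_le_mono[OF _ z(2)[of x], of "Suc N'"]
      by (simp add: norm_minus_commute real_root_power_cancel del: power_Suc)
    ultimately have "((\<lambda>x. norm (z x - c)) \<longlongrightarrow> 0) \<F>"
      by (intro Lim_null_comparison[of "\<lambda>x. norm (z x - c)"]) auto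
    thus ?thesis by (simp add: tendsto_norm_zero_iff LIM_zero_cancel)
  qed
  have split: "proots (p x) = add_mset (z x) (proots (synthetic_div (p x) (z x)))" for x
    by (rule proots_eq_add_root[OF z(1) p0(2)])
  have split0: "proots p0 = add_mset c (proots (synthetic_div p0 c))"
    by (rule proots_eq_add_root[OF root p0(1)])
  have "\<exists>\<delta>>0. \<forall>\<^sub>F x in \<F>. size {#y \<in># proots (synthetic_div (p x) (z x)). dist y c < \<delta>#} = m"
  proof (rule Suc.IH[of _ "synthetic_div p0 c" N'])
    show "((\<lambda>x. coeff (synthetic_div (p x) (z x)) k) \<longlongrightarrow> coeff (synthetic_div p0 c) k) \<F>" for k
      using Suc.prems by (intro tendsto_coeff_synthetic_div[where N = N] z_lim) auto
    show "count (proots (synthetic_div p0 c)) c = m"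
      using Suc.prems(6) unfolding split0 by simp
  qed (use Suc.prems N monic_synthetic_div in auto)
  then obtain \<delta> where \<delta>: "\<delta> > 0"
    "\<forall>\<^sub>F x in \<F>. size {#y \<in># proots (synthetic_div (p x) (z x)). dist y c < \<delta>#} = m" by blast
  have "\<forall>\<^sub>F x in \<F>. dist (z x) c < \<delta>" using z_lim \<delta>(1) by (rule tendstoD)
  with \<delta>(2) have "\<forall>\<^sub>F x in \<F>. size {#y \<in># proots (p x). dist y c < \<delta>#} = Suc m"
    by eventually_elim (simp add: split)
  with \<delta>(1) show ?case by blast
qed

section \<open>Characteristic polynomials\<close>

definition char_matrix :: "complex ^ 'n ^ 'n \<Rightarrow> complex poly ^ 'n ^ 'n" where
  "char_matrix M = mat [:0, 1:] - map_matrix (\<lambda>x. [:x:]) M"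

lemma char_matrix_nth: "char_matrix M $ k $ l = (if k = l then [:- M $ k $ k, 1:] else [:- M $ k $ l:])"
  by (simp add: char_matrix_def mat_def)

text \<open>In the Leibniz formula only the identity permutation yields a product of full degree: every
  other permutation moves some index and thus picks a constant entry.\<close>

lemma charpoly_degree_monic:
  fixes M :: "complex ^ 'n ^ 'n"
  shows "degree (charpoly M) = CARD('n)" and "lead_coeff (charpoly M) = 1"
proof -
  let ?N = "CARD('n)" and ?P = "{p. p permutes (UNIV :: 'n set)}"
  let ?t = "\<lambda>p. of_int (sign p) * (\<Prod>k\<in>UNIV. char_matrix M $ k $ p k)"
  have cp: "charpoly M = (\<Sum>p\<in>?P. ?t p)"
    by (simp add: charpoly_def det_def char_matrix_def)
  have diag: "degree (\<Prod>k\<in>(UNIV :: 'n set). [:- M $ k $ k, 1:]) = ?N"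
    "lead_coeff (\<Prod>k\<in>(UNIV :: 'n set). [:- M $ k $ k, 1:]) = 1"
    by (simp add: degree_prod_eq_sum_degree) (simp only: lead_coeff_prod, simp)
  have off: "degree (?t p) < ?N" if "p permutes UNIV" and ne: "p \<noteq> id" for p
  proof -
    obtain k where k: "p k \<noteq> k" using ne by (auto simp: fun_eq_iff)
    have sgn: "(of_int (sign p) :: complex poly) = [:of_int (sign p):]"
      by (simp add: of_int_poly)
    have "degree (?t p) \<le> degree (\<Prod>k\<in>UNIV. char_matrix M $ k $ p k)"
      unfolding sgn by (simp add: degree_smult_le)
    also have "\<dots> \<le> (\<Sum>k\<in>UNIV. degree (char_matrix M $ k $ p k))"
      by (rule order_trans[OF degree_prod_sum_le]) (auto simp: o_def)
    also have "\<dots> \<le> (\<Sum>m\<in>UNIV. if m = k then 0 else 1)"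
      using k by (intro sum_mono) (auto simp: char_matrix_nth)
    also have "\<dots> = card (UNIV - {k})"
      by (simp add: sum.If_cases Compl_eq_Diff_UNIV Collect_neg_eq)
    also have "\<dots> < ?N" by (intro psubset_card_mono) auto
    finally show ?thesis .
  qed
  have fin: "finite ?P" by (simp add: finite_permutations)
  have "charpoly M = ?t id + (\<Sum>p\<in>?P - {id}. ?t p)"
    unfolding cp using fin by (intro sum.remove) (auto simp: permutes_id)
  also have "?t id = (\<Prod>k\<in>(UNIV :: 'n set). [:- M $ k $ k, 1:])"
    by (simp add: char_matrix_nth)
  finally have eq: "charpoly M = (\<Prod>k\<in>(UNIV :: 'n set). [:- M $ k $ k, 1:]) + (\<Sum>p\<in>?P - {id}. ?t p)" .
  have rest: "degree (\<Sum>p\<in>?P - {id}. ?t p) < ?N"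
    using off by (intro degree_sum_less) auto
  show deg: "degree (charpoly M) = ?N"
    unfolding eq using rest diag(1) by (simp add: degree_add_eq_left)
  show "lead_coeff (charpoly M) = 1"
    unfolding deg unfolding eq coeff_add coeff_eq_0[OF rest] using diag by simp
qed

lemma charpoly_diagonal:
  fixes M :: "complex ^ 'n ^ 'n"
  assumes "diagonal M"
  shows "charpoly M = (\<Prod>k\<in>UNIV. [:- M $ k $ k, 1:])"
  unfolding charpoly_def
  by (subst det_diagonal) (use assms in \<open>auto simp: diagonal_def mat_def\<close>)

lemma count_eigenvalues_diagonal:
  fixes M :: "complex ^ 'n ^ 'n"
  assumes "diagonal M"
  shows "count (eigenvalues M) f = card {l. M $ l $ l = f}"
proof -
  have "eigenvalues M = (\<Sum>k\<in>UNIV. {#M $ k $ k#})"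
    unfolding eigenvalues_def charpoly_diagonal[OF assms]
    by (subst proots_prod) auto
  hence "count (eigenvalues M) f = (\<Sum>k\<in>UNIV. if M $ k $ k = f then 1 else 0)"
    by (simp only: count_sum count_single)
  thus ?thesis by (simp add: sum.If_cases)
qed

lemma tendsto_coeff_prod:
  fixes p :: "'b \<Rightarrow> 'i \<Rightarrow> complex poly"
  assumes "\<And>i k. i \<in> I \<Longrightarrow> ((\<lambda>x. coeff (p x i) k) \<longlongrightarrow> coeff (p0 i) k) \<F>"
  shows "((\<lambda>x. coeff (\<Prod>i\<in>I. p x i) k) \<longlongrightarrow> coeff (\<Prod>i\<in>I. p0 i) k) \<F>"
  using assms
proof (induction I arbitrary: k rule: infinite_finite_induct)
  case (insert i I)
  thus ?case by (simp add: coeff_mult) (intro tendsto_intros, auto)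
qed auto

lemma tendsto_coeff_charpoly:
  fixes M :: "'b \<Rightarrow> complex ^ 'n ^ 'n"
  assumes "(M \<longlongrightarrow> M0) \<F>"
  shows "((\<lambda>x. coeff (charpoly (M x)) k) \<longlongrightarrow> coeff (charpoly M0) k) \<F>"
proof -
  have cp: "coeff (charpoly M) k = (\<Sum>p | p permutes UNIV. of_int (sign p) * coeff (\<Prod>l\<in>UNIV. char_matrix M $ l $ p l) k)"
    for M :: "complex ^ 'n ^ 'n"
    by (simp add: charpoly_def det_def char_matrix_def coeff_sum of_int_poly)
  have entry: "((\<lambda>x. coeff (char_matrix (M x) $ l $ q) j) \<longlongrightarrow> coeff (char_matrix M0 $ l $ q) j) \<F>" for l q j
    unfolding char_matrix_nth
    by (auto simp: coeff_pCons split: nat.splits intro!: tendsto_intros assms)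
  show ?thesis unfolding cp
    by (intro tendsto_intros tendsto_coeff_prod entry)
qed

lemma number_of_eigenvalues_near:
  fixes M :: "'b \<Rightarrow> complex ^ 'n ^ 'n"
  assumes "(M \<longlongrightarrow> M0) \<F>"
  shows "\<exists>\<delta>>0. \<forall>\<^sub>F x in \<F>. size {#z \<in># eigenvalues (M x). dist z f < \<delta>#} = count (eigenvalues M0) f"
  unfolding eigenvalues_def
  by (rule number_of_roots_near[where N = "CARD('n)", OF tendsto_coeff_charpoly[OF assms]])
    (rule charpoly_degree_monic refl)+

section \<open>Errors of order one in the perturbation parameter\<close>

text \<open>Convergence with an error that is linear in \<open>\<epsilon>\<close>. It is preserved by ring operations and
  therefore passes from the entries of a matrix to its determinant.\<close>

definition eps_close :: "(complex \<Rightarrow> complex) \<Rightarrow> complex \<Rightarrow> bool" where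
  "eps_close g a \<longleftrightarrow> (\<lambda>\<epsilon>. g \<epsilon> - a) \<in> O[at 0](\<lambda>\<epsilon>. \<epsilon>)"

lemma eps_close_const [simp]: "eps_close (\<lambda>_. a) a"
  by (simp add: eps_close_def)

lemma eps_close_ident: "eps_close (\<lambda>\<epsilon>. \<epsilon>) 0"
  by (simp add: eps_close_def)

lemma eps_close_add: "eps_close g a \<Longrightarrow> eps_close h b \<Longrightarrow> eps_close (\<lambda>\<epsilon>. g \<epsilon> + h \<epsilon>) (a + b)"
  unfolding eps_close_def by (drule (1) sum_in_bigo(1)) (simp add: algebra_simps)

lemma eps_close_diff: "eps_close g a \<Longrightarrow> eps_close h b \<Longrightarrow> eps_close (\<lambda>\<epsilon>. g \<epsilon> - h \<epsilon>) (a - b)"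
  unfolding eps_close_def by (drule (1) sum_in_bigo(2)) (simp add: algebra_simps)

lemma eps_close_bounded: "eps_close g a \<Longrightarrow> g \<in> O[at 0](\<lambda>_. 1)"
proof -
  assume "eps_close g a"
  hence "(\<lambda>\<epsilon>. g \<epsilon> - a) \<in> O[at 0](\<lambda>\<epsilon>. \<epsilon>)" by (simp add: eps_close_def)
  also have "(\<lambda>\<epsilon>::complex. \<epsilon>) \<in> O[at 0](\<lambda>_. 1)"
    by (rule bigoI_tendsto[where c = 0]) (auto intro!: tendsto_eq_intros)
  finally have "(\<lambda>\<epsilon>. (g \<epsilon> - a) + a) \<in> O[at 0](\<lambda>_. 1)"
    by (rule sum_in_bigo(1)) simp
  thus ?thesis by simp
qed

lemma eps_close_mult:
  assumes "eps_close g a" "eps_close h b"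
  shows "eps_close (\<lambda>\<epsilon>. g \<epsilon> * h \<epsilon>) (a * b)"
proof -
  have "(\<lambda>\<epsilon>. (g \<epsilon> - a) * h \<epsilon>) \<in> O[at 0](\<lambda>\<epsilon>. \<epsilon> * 1)"
    using assms eps_close_bounded unfolding eps_close_def by (intro landau_o.big.mult) auto
  moreover have "(\<lambda>\<epsilon>. a * (h \<epsilon> - b)) \<in> O[at 0](\<lambda>\<epsilon>. \<epsilon>)"
    using assms unfolding eps_close_def by simp
  ultimately have "(\<lambda>\<epsilon>. (g \<epsilon> - a) * h \<epsilon> + a * (h \<epsilon> - b)) \<in> O[at 0](\<lambda>\<epsilon>. \<epsilon>)"
    by (intro sum_in_bigo) simp_all
  thus ?thesis by (simp add: eps_close_def algebra_simps)
qed

lemma eps_close_sum: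
  "(\<And>i. i \<in> I \<Longrightarrow> eps_close (\<lambda>\<epsilon>. g \<epsilon> i) (a i)) \<Longrightarrow> eps_close (\<lambda>\<epsilon>. \<Sum>i\<in>I. g \<epsilon> i) (\<Sum>i\<in>I. a i)"
  by (induction I rule: infinite_finite_induct) (auto intro: eps_close_add)

lemma eps_close_prod:
  "(\<And>i. i \<in> I \<Longrightarrow> eps_close (\<lambda>\<epsilon>. g \<epsilon> i) (a i)) \<Longrightarrow> eps_close (\<lambda>\<epsilon>. \<Prod>i\<in>I. g \<epsilon> i) (\<Prod>i\<in>I. a i)"
  by (induction I rule: infinite_finite_induct) (auto intro: eps_close_mult)

lemma eps_close_tendsto: "eps_close g a \<Longrightarrow> (g \<longlongrightarrow> a) (at 0)"
proof -
  assume "eps_close g a"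
  hence "(\<lambda>\<epsilon>. g \<epsilon> - a) \<in> O[at 0](\<lambda>\<epsilon>. \<epsilon>)" by (simp add: eps_close_def)
  also have "(\<lambda>\<epsilon>::complex. \<epsilon>) \<in> o[at 0](\<lambda>_. 1)"
    by (rule smalloI_tendsto) (auto intro!: tendsto_eq_intros)
  finally have "((\<lambda>\<epsilon>. g \<epsilon> - a) \<longlongrightarrow> 0) (at 0)" by (auto dest: smalloD_tendsto)
  thus ?thesis by (simp add: LIM_zero_iff)
qed

lemma eps_close_inverse:
  assumes "eps_close g a" "a \<noteq> 0"
  shows "eps_close (\<lambda>\<epsilon>. inverse (g \<epsilon>)) (inverse a)"
proof -
  have lim: "(g \<longlongrightarrow> a) (at 0)" using assms(1) by (rule eps_close_tendsto)
  have "((\<lambda>\<epsilon>. - inverse a * inverse (g \<epsilon>)) \<longlongrightarrow> - inverse a * inverse a) (at 0)"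
    by (intro tendsto_intros lim assms)
  hence "(\<lambda>\<epsilon>. - inverse a * inverse (g \<epsilon>)) \<in> O[at 0](\<lambda>_. 1)"
    by (intro bigoI_tendsto[where c = "- inverse a * inverse a"]) auto
  hence "(\<lambda>\<epsilon>. (g \<epsilon> - a) * (- inverse a * inverse (g \<epsilon>))) \<in> O[at 0](\<lambda>\<epsilon>. \<epsilon> * 1)"
    using assms(1) unfolding eps_close_def by (intro landau_o.big.mult)
  moreover have "\<forall>\<^sub>F \<epsilon> in at 0. (g \<epsilon> - a) * (- inverse a * inverse (g \<epsilon>)) = inverse (g \<epsilon>) - inverse a"
    using tendsto_imp_eventually_ne[OF lim assms(2)]
    by eventually_elim (use assms(2) in \<open>simp add: field_simps\<close>)
  ultimately show ?thesis unfolding eps_close_def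
    using landau_o.big.in_cong[of "\<lambda>\<epsilon>. (g \<epsilon> - a) * (- inverse a * inverse (g \<epsilon>))" "\<lambda>\<epsilon>. inverse (g \<epsilon>) - inverse a" "at 0"]
    by simp
qed

lemma eps_close_cong:
  assumes "\<forall>\<^sub>F \<epsilon> in at 0. g \<epsilon> = h \<epsilon>" "eps_close g a"
  shows "eps_close h a"
proof -
  have "\<forall>\<^sub>F \<epsilon> in at 0. g \<epsilon> - a = h \<epsilon> - a" using assms(1) by eventually_elim simp
  from landau_o.big.in_cong[OF this] show ?thesis using assms(2) unfolding eps_close_def by blast
qed

lemma eps_close_det:
  fixes M :: "complex \<Rightarrow> complex ^ 'n ^ 'n"
  assumes "\<And>k l. eps_close (\<lambda>\<epsilon>. M \<epsilon> $ k $ l) (M0 $ k $ l)"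
  shows "eps_close (\<lambda>\<epsilon>. det (M \<epsilon>)) (det M0)"
  unfolding det_def by (intro eps_close_sum eps_close_mult eps_close_prod eps_close_const assms)

section \<open>The characteristic polynomial near a double eigenvalue\<close>

text \<open>A permutation that moves an index outside \<open>{i, j}\<close> picks a zero entry, which leaves the
  identity and the transposition of \<open>i\<close> and \<open>j\<close> in the Leibniz formula.\<close>

lemma det_two_nondiagonal_rows:
  fixes M :: "complex ^ 'n ^ 'n"
  assumes ij: "i \<noteq> j" and M: "\<And>k l. k \<noteq> i \<Longrightarrow> k \<noteq> j \<Longrightarrow> k \<noteq> l \<Longrightarrow> M $ k $ l = 0"
  shows "det M = (\<Prod>k\<in>UNIV - {i, j}. M $ k $ k) * (M $ i $ i * M $ j $ j - M $ i $ j * M $ j $ i)"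
proof -
  let ?t = "\<lambda>p. of_int (sign p) * (\<Prod>k\<in>UNIV. M $ k $ p k)"
  have pr: "(\<Prod>k\<in>UNIV. h k) = h i * h j * (\<Prod>k\<in>UNIV - {i, j}. h k)" for h :: "'n \<Rightarrow> complex"
  proof -
    have "(\<Prod>k\<in>UNIV. h k) = (\<Prod>k\<in>{i, j}. h k) * (\<Prod>k\<in>UNIV - {i, j}. h k)"
      by (subst prod.union_disjoint[symmetric]) (auto intro!: prod.cong)
    thus ?thesis using ij by simp
  qed
  have "det M = (\<Sum>p | p permutes {i, j}. ?t p)"
    unfolding det_def
  proof (rule sum.mono_neutral_right)
    show "finite {p. p permutes (UNIV :: 'n set)}" by (simp add: finite_permutations)
    show "{p. p permutes {i, j}} \<subseteq> {p. p permutes UNIV}" by (auto intro: permutes_subset)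
    show "\<forall>p \<in> {p. p permutes UNIV} - {p. p permutes {i, j}}. ?t p = 0"
    proof
      fix p assume p: "p \<in> {p. p permutes UNIV} - {p. p permutes {i, j}}"
      then obtain k where k: "k \<notin> {i, j}" "p k \<noteq> k" unfolding permutes_def by blast
      hence "M $ k $ p k = 0" by (intro M) auto
      hence "(\<Prod>k\<in>UNIV. M $ k $ p k) = 0" by (intro prod_zero) auto
      thus "?t p = 0" by simp
    qed
  qed
  also have "{p. p permutes {i, j}} = {id, Transposition.transpose i j}"
    by (auto simp: permutes_doubleton_iff)
  also have "(\<Sum>p\<in>{id, Transposition.transpose i j}. ?t p) = ?t id + ?t (Transposition.transpose i j)"
  proof -
    have "id \<noteq> Transposition.transpose i j"
      using ij by (metis id_apply transpose_apply_first)
    thus ?thesis by simp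
  qed
  also have "?t id = M $ i $ i * M $ j $ j * (\<Prod>k\<in>UNIV - {i, j}. M $ k $ k)"
    by (subst pr) (simp add: sign_id)
  also have "?t (Transposition.transpose i j) = - (M $ i $ j * M $ j $ i * (\<Prod>k\<in>UNIV - {i, j}. M $ k $ k))"
  proof -
    have "(\<Prod>k\<in>UNIV - {i, j}. M $ k $ Transposition.transpose i j k) = (\<Prod>k\<in>UNIV - {i, j}. M $ k $ k)"
      by (intro prod.cong) (auto simp: transpose_def)
    thus ?thesis using ij by (subst pr) (simp add: sign_swap_id)
  qed
  finally show ?thesis by (simp add: algebra_simps)
qed

text \<open>In the rows \<open>i\<close> and \<open>j\<close> of \<open>mat (f + \<epsilon> * w) - F \<epsilon>\<close> the terms of order zero cancel,
  so a factor \<open>\<epsilon>\<close> can be taken out of each. What remains converges, with linear error, to a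
  matrix whose other rows are diagonal.\<close>

lemma eps_close_rescaled_char_det:
  fixes F :: "complex \<Rightarrow> complex ^ 'n ^ 'n"
  assumes F_rem: "\<forall>\<^sub>F \<epsilon> in at 0. norm (F \<epsilon> - F0 - \<epsilon> *\<^sub>C F1) \<le> K * norm \<epsilon> ^ 2"
    and F0: "diagonal F0" and ij: "i \<noteq> j" "F0 $ i $ i = f" "F0 $ j $ j = f"
  shows "eps_close (\<lambda>\<epsilon>. det (mat (f + \<epsilon> * w) - F \<epsilon>) / \<epsilon>\<^sup>2)
    ((\<Prod>k\<in>UNIV - {i, j}. f - F0 $ k $ k) *
     ((w - F1 $ i $ i) * (w - F1 $ j $ j) - F1 $ i $ j * F1 $ j $ i))"
proof -
  have quot: "eps_close (\<lambda>\<epsilon>. (F \<epsilon> - F0) $ k $ l / \<epsilon>) (F1 $ k $ l)" for k l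
    unfolding eps_close_def
  proof (rule bigoI[where c = K])
    show "\<forall>\<^sub>F \<epsilon> in at 0. norm ((F \<epsilon> - F0) $ k $ l / \<epsilon> - F1 $ k $ l) \<le> K * norm \<epsilon>"
      using F_rem eventually_neq_at_within[of 0]
    proof eventually_elim
      case (elim \<epsilon>)
      have "(F \<epsilon> - F0) $ k $ l / \<epsilon> - F1 $ k $ l = (F \<epsilon> - F0 - \<epsilon> *\<^sub>C F1) $ k $ l / \<epsilon>"
        using elim by (simp add: field_simps)
      also have "norm \<dots> \<le> K * norm \<epsilon> ^ 2 / norm \<epsilon>"
        unfolding norm_divide using order_trans[OF norm_matrix_nth_le elim(1)]
        by (intro divide_right_mono) auto
      finally show ?case using elim by (simp add: power2_eq_square)
    qed
  qed
  have F_close: "eps_close (\<lambda>\<epsilon>. F \<epsilon> $ k $ l) (F0 $ k $ l)" for k l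
  proof (rule eps_close_cong)
    show "\<forall>\<^sub>F \<epsilon> in at 0. F0 $ k $ l + \<epsilon> * ((F \<epsilon> - F0) $ k $ l / \<epsilon>) = F \<epsilon> $ k $ l"
      using eventually_neq_at_within[of 0] by eventually_elim simp
    show "eps_close (\<lambda>\<epsilon>. F0 $ k $ l + \<epsilon> * ((F \<epsilon> - F0) $ k $ l / \<epsilon>)) (F0 $ k $ l)"
      using eps_close_add[OF eps_close_const eps_close_mult[OF eps_close_ident quot]] by simp
  qed
  define I where "I = (mat 1 :: complex ^ 'n ^ 'n)"
  have mat_I: "(mat x :: complex ^ 'n ^ 'n) $ k $ l = x * I $ k $ l" for x k l
    by (simp add: I_def mat_def)
  \<comment> \<open>The matrix after division of the rows \<open>i\<close> and \<open>j\<close> by \<open>\<epsilon>\<close>, and its limit.\<close>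
  define N where "N \<epsilon> = (\<chi> k l. if k \<in> {i, j} then w * I $ k $ l - (F \<epsilon> - F0) $ k $ l / \<epsilon>
     else (f + \<epsilon> * w) * I $ k $ l - F \<epsilon> $ k $ l)" for \<epsilon>
  define N0 where "N0 = (\<chi> k l. if k \<in> {i, j} then w * I $ k $ l - F1 $ k $ l
     else f * I $ k $ l - F0 $ k $ l)"
  have "eps_close (\<lambda>\<epsilon>. N \<epsilon> $ k $ l) (N0 $ k $ l)" for k l
  proof (cases "k \<in> {i, j}")
    case True
    thus ?thesis
      using eps_close_diff[OF eps_close_const quot] by (auto simp: N_def N0_def)
  next
    case False
    have "eps_close (\<lambda>\<epsilon>. (f + \<epsilon> * w) * I $ k $ l - F \<epsilon> $ k $ l) ((f + 0 * w) * I $ k $ l - F0 $ k $ l)"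
      by (intro eps_close_diff eps_close_mult eps_close_add eps_close_const eps_close_ident F_close)
    thus ?thesis using False by (simp add: N_def N0_def)
  qed
  hence "eps_close (\<lambda>\<epsilon>. det (N \<epsilon>)) (det N0)" by (rule eps_close_det)
  moreover have "\<forall>\<^sub>F \<epsilon> in at 0. det (N \<epsilon>) = det (mat (f + \<epsilon> * w) - F \<epsilon>) / \<epsilon>\<^sup>2"
    using eventually_neq_at_within[of 0]
  proof eventually_elim
    case (elim \<epsilon>)
    have F0_row: "F0 $ k $ l = f * I $ k $ l" if "k \<in> {i, j}" for k l
      using F0 ij that by (auto simp: diagonal_def I_def mat_def)
    have "mat (f + \<epsilon> * w) - F \<epsilon> = (\<chi> k. (if k \<in> {i, j} then \<epsilon> else 1) *s N \<epsilon> $ k)"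
      using elim F0_row unfolding vec_eq_iff
      by (auto simp: N_def mat_I field_simps)
    hence "det (mat (f + \<epsilon> * w) - F \<epsilon>) = (\<Prod>k\<in>UNIV. if k \<in> {i, j} then \<epsilon> else 1) * det (N \<epsilon>)"
      by (simp only: det_rows_mul vec_lambda_eta)
    also have "(\<Prod>k\<in>UNIV. if k \<in> {i, j} then \<epsilon> else 1) = \<epsilon> ^ card {i, j}"
      by (simp only: prod.If_cases finite Int_UNIV_left Collect_mem_eq) simp
    finally show ?case using elim ij by (simp add: power2_eq_square)
  qed
  moreover have "det N0 = (\<Prod>k\<in>UNIV - {i, j}. f - F0 $ k $ k) *
     ((w - F1 $ i $ i) * (w - F1 $ j $ j) - F1 $ i $ j * F1 $ j $ i)"
  proof -
    have "det N0 = (\<Prod>k\<in>UNIV - {i, j}. N0 $ k $ k) * (N0 $ i $ i * N0 $ j $ j - N0 $ i $ j * N0 $ j $ i)"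
      using F0 by (intro det_two_nondiagonal_rows[OF ij(1)]) (auto simp: N0_def diagonal_def I_def mat_def)
    also have "(\<Prod>k\<in>UNIV - {i, j}. N0 $ k $ k) = (\<Prod>k\<in>UNIV - {i, j}. f - F0 $ k $ k)"
      by (intro prod.cong) (auto simp: N0_def I_def mat_def)
    finally show ?thesis using ij by (simp add: N0_def I_def mat_def)
  qed
  ultimately show ?thesis using eps_close_cong by auto
qed

section \<open>Splitting of a double eigenvalue\<close>

lemma prod_mset_near_one:
  fixes U :: "complex multiset"
  assumes "\<And>u. u \<in># U \<Longrightarrow> norm u \<le> x" "0 \<le> x" "x \<le> 1"
  shows "norm ((\<Prod>u\<in>#U. 1 + u) - 1) \<le> (2 ^ size U - 1) * x"
  using assms
proof (induction U)
  case (add u U)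
  let ?P = "\<Prod>u\<in>#U. 1 + u"
  have IH: "norm (?P - 1) \<le> (2 ^ size U - 1) * x" and u: "norm u \<le> x"
    using add by auto
  have "(1 + u) * ?P - 1 = (1 + u) * (?P - 1) + u" by (simp add: algebra_simps)
  hence "norm ((1 + u) * ?P - 1) \<le> norm (1 + u) * norm (?P - 1) + norm u"
    by (metis norm_mult norm_triangle_ineq)
  also have "\<dots> \<le> 2 * ((2 ^ size U - 1) * x) + x"
  proof (intro add_mono mult_mono IH u)
    show "norm (1 + u) \<le> 2" using norm_triangle_ineq[of 1 u] u add.prems(3) norm_one[where 'a = complex] by linarith
  qed auto
  finally show ?case by (simp add: algebra_simps)
qed simp

text \<open>From \<open>(h - s) (h + s) = h\<^sup>2 - s\<^sup>2\<close>: if \<open>h - s\<close> is the smaller factor, its square is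
  bounded by the right hand side. If moreover \<open>s \<noteq> 0\<close>, the larger factor is at least
  \<open>norm s\<close> and the error stays linear.\<close>

lemma nearer_square_root:
  fixes h :: "complex \<Rightarrow> complex"
  assumes sq: "eps_close (\<lambda>\<epsilon>. h \<epsilon> ^ 2) (s ^ 2)"
    and near: "\<forall>\<^sub>F \<epsilon> in at 0. norm (h \<epsilon> - s) \<le> norm (h \<epsilon> + s)"
  shows "(h \<longlongrightarrow> s) (at 0)" and "s \<noteq> 0 \<Longrightarrow> eps_close h s"
proof -
  have fac: "norm (h \<epsilon> ^ 2 - s ^ 2) = norm (h \<epsilon> - s) * norm (h \<epsilon> + s)" for \<epsilon>
    unfolding norm_mult[symmetric] by (simp add: power2_eq_square algebra_simps)
  have "((\<lambda>\<epsilon>. h \<epsilon> ^ 2 - s ^ 2) \<longlongrightarrow> 0) (at 0)"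
    using eps_close_tendsto[OF sq] by (simp add: LIM_zero_iff)
  hence lim: "((\<lambda>\<epsilon>. sqrt (norm (h \<epsilon> ^ 2 - s ^ 2))) \<longlongrightarrow> sqrt 0) (at 0)"
    by (intro tendsto_real_sqrt tendsto_norm_zero)
  have le: "\<forall>\<^sub>F \<epsilon> in at 0. norm (h \<epsilon> - s) \<le> sqrt (norm (h \<epsilon> ^ 2 - s ^ 2))"
    using near
  proof eventually_elim
    case (elim \<epsilon>)
    have "norm (h \<epsilon> - s) ^ 2 \<le> norm (h \<epsilon> ^ 2 - s ^ 2)"
      unfolding fac power2_eq_square[of "norm (h \<epsilon> - s)"] using elim by (intro mult_left_mono) auto
    thus ?case by (rule real_le_rsqrt)
  qed
  have "((\<lambda>\<epsilon>. h \<epsilon> - s) \<longlongrightarrow> 0) (at 0)"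
    by (rule Lim_null_comparison[OF le lim[unfolded real_sqrt_zero]])
  thus "(h \<longlongrightarrow> s) (at 0)" by (simp add: LIM_zero_iff)
  assume s: "s \<noteq> 0"
  have "(\<lambda>\<epsilon>. h \<epsilon> - s) \<in> O[at 0](\<lambda>\<epsilon>. h \<epsilon> ^ 2 - s ^ 2)"
  proof (rule bigoI[where c = "1 / norm s"])
    show "\<forall>\<^sub>F \<epsilon> in at 0. norm (h \<epsilon> - s) \<le> 1 / norm s * norm (h \<epsilon> ^ 2 - s ^ 2)"
      using near
    proof eventually_elim
      case (elim \<epsilon>)
      have "2 * norm s \<le> norm (h \<epsilon> + s) + norm (h \<epsilon> - s)"
        using norm_triangle_ineq4[of "h \<epsilon> + s" "h \<epsilon> - s"] by (simp add: norm_mult)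
      hence "norm s \<le> norm (h \<epsilon> + s)" using elim by simp
      hence "norm (h \<epsilon> - s) * norm s \<le> norm (h \<epsilon> ^ 2 - s ^ 2)"
        unfolding fac by (intro mult_left_mono) auto
      thus ?case using s by (simp add: field_simps)
    qed
  qed
  also have "(\<lambda>\<epsilon>. h \<epsilon> ^ 2 - s ^ 2) \<in> O[at 0](\<lambda>\<epsilon>. \<epsilon>)" using sq by (simp add: eps_close_def)
  finally show "eps_close h s" by (simp add: eps_close_def)
qed

text \<open>Two monic quadratics that are proportional up to \<open>O(\<epsilon>)\<close> are equal up to \<open>O(\<epsilon>)\<close>. The
  second difference of the values at \<open>-1, 0, 1\<close> isolates the leading coefficients and gives
  \<open>\<kappa> = 1 + O(\<epsilon>)\<close>. Bounds for the roots and for \<open>\<kappa>\<close> come out of the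
  comparison.\<close>

lemma quadratic_from_three_values:
  fixes w1 w2 \<kappa> :: "complex \<Rightarrow> complex"
  assumes close: "\<And>w. (\<lambda>\<epsilon>. (w - w1 \<epsilon>) * (w - w2 \<epsilon>) - \<kappa> \<epsilon> * (w\<^sup>2 - 2 * c * w + d)) \<in> O[at 0](\<lambda>\<epsilon>. \<epsilon>)"
  shows "eps_close (\<lambda>\<epsilon>. w1 \<epsilon> + w2 \<epsilon>) (2 * c)" and "eps_close (\<lambda>\<epsilon>. w1 \<epsilon> * w2 \<epsilon>) d"
proof -
  define E where "E w \<epsilon> = (w - w1 \<epsilon>) * (w - w2 \<epsilon>)" for w \<epsilon>
  define Q where "Q w = w\<^sup>2 - 2 * c * w + d" for w
  have close': "(\<lambda>\<epsilon>. E w \<epsilon> - \<kappa> \<epsilon> * Q w) \<in> O[at 0](\<lambda>\<epsilon>. \<epsilon>)" for w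
    unfolding E_def Q_def by (rule close)
  have "(\<lambda>\<epsilon>. (E 1 \<epsilon> - \<kappa> \<epsilon> * Q 1) + (E (-1) \<epsilon> - \<kappa> \<epsilon> * Q (-1)) - 2 * (E 0 \<epsilon> - \<kappa> \<epsilon> * Q 0))
      \<in> O[at 0](\<lambda>\<epsilon>. \<epsilon>)"
    by (intro sum_in_bigo close' landau_o.big.cmult_in_iff[THEN iffD2]) (simp_all add: close')
  also have "(\<lambda>\<epsilon>. (E 1 \<epsilon> - \<kappa> \<epsilon> * Q 1) + (E (-1) \<epsilon> - \<kappa> \<epsilon> * Q (-1)) - 2 * (E 0 \<epsilon> - \<kappa> \<epsilon> * Q 0))
      = (\<lambda>\<epsilon>. (-2) * (\<kappa> \<epsilon> - 1))"
    by (simp add: fun_eq_iff E_def Q_def algebra_simps power2_eq_square)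
  finally have \<kappa>: "eps_close \<kappa> 1"
    unfolding eps_close_def by (subst (asm) landau_o.big.cmult_in_iff) auto
  have E: "eps_close (E w) (Q w)" for w
  proof -
    have "eps_close (\<lambda>\<epsilon>. \<kappa> \<epsilon> * Q w + (E w \<epsilon> - \<kappa> \<epsilon> * Q w)) (1 * Q w + 0)"
      using close' by (intro eps_close_add eps_close_mult \<kappa> eps_close_const) (simp add: eps_close_def)
    thus ?thesis by simp
  qed
  have "eps_close (\<lambda>\<epsilon>. (E (-1) \<epsilon> - E 1 \<epsilon>) * (1 / 2)) ((Q (-1) - Q 1) * (1 / 2))"
    by (intro eps_close_mult eps_close_diff E eps_close_const)
  thus "eps_close (\<lambda>\<epsilon>. w1 \<epsilon> + w2 \<epsilon>) (2 * c)"
    by (simp add: E_def Q_def algebra_simps)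
  show "eps_close (\<lambda>\<epsilon>. w1 \<epsilon> * w2 \<epsilon>) d"
    using E[of 0] by (simp add: E_def [abs_def] Q_def)
qed

lemma eigenvalue_product:
  fixes M :: "complex ^ 'n ^ 'n"
  shows "det (mat x - M) = (\<Prod>z\<in>#eigenvalues M. x - z)"
  unfolding eigenvalues_def poly_charpoly[symmetric]
  by (rule monic_poly_eq_prod_roots[OF charpoly_degree_monic(2)])

lemma size_eigenvalues: "size (eigenvalues (M :: complex ^ 'n ^ 'n)) = CARD('n)"
  by (simp add: eigenvalues_def size_proots_complex charpoly_degree_monic(1))

text \<open>Each factor of the quotient is \<open>1 + \<epsilon> * w / (f - z)\<close> with denominator at least
  \<open>\<delta>\<close>, and the number of factors is bounded.\<close>

lemma far_eigenvalues_ratio: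
  fixes U :: "complex \<Rightarrow> complex multiset"
  assumes far: "\<And>\<epsilon> z. z \<in># U \<epsilon> \<Longrightarrow> \<delta> \<le> norm (f - z)" and size: "\<And>\<epsilon>. size (U \<epsilon>) \<le> N" and "\<delta> > 0"
  shows "eps_close (\<lambda>\<epsilon>. (\<Prod>z\<in>#U \<epsilon>. f + \<epsilon> * w - z) / (\<Prod>z\<in>#U \<epsilon>. f - z)) 1"
  unfolding eps_close_def
proof (rule bigoI[where c = "2 ^ N * (norm w / \<delta>)"])
  have "((\<lambda>\<epsilon>::complex. norm \<epsilon> * (norm w / \<delta>)) \<longlongrightarrow> norm (0::complex) * (norm w / \<delta>)) (at 0)"
    by (rule tendsto_mult[OF tendsto_norm[OF tendsto_ident_at] tendsto_const])
  hence "\<forall>\<^sub>F \<epsilon> in at 0. norm (\<epsilon>::complex) * (norm w / \<delta>) < 1"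
    by (rule order_tendstoD) simp
  thus "\<forall>\<^sub>F \<epsilon> in at 0. norm ((\<Prod>z\<in>#U \<epsilon>. f + \<epsilon> * w - z) / (\<Prod>z\<in>#U \<epsilon>. f - z) - 1)
      \<le> 2 ^ N * (norm w / \<delta>) * norm \<epsilon>"
  proof eventually_elim
    case (elim \<epsilon>)
    define V where "V = image_mset (\<lambda>z. \<epsilon> * w / (f - z)) (U \<epsilon>)"
    have nz: "f \<noteq> z" if "z \<in># U \<epsilon>" for z using far[OF that] \<open>\<delta> > 0\<close> by auto
    have "(\<Prod>z\<in>#U \<epsilon>. f + \<epsilon> * w - z) = (\<Prod>z\<in>#U \<epsilon>. (f - z) * (1 + \<epsilon> * w / (f - z)))"
      by (intro arg_cong[where f = prod_mset] image_mset_cong) (use nz in \<open>auto simp: field_simps\<close>)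
    also have "\<dots> = (\<Prod>z\<in>#U \<epsilon>. f - z) * (\<Prod>v\<in>#V. 1 + v)"
      by (simp add: prod_mset.distrib V_def image_mset.compositionality o_def)
    finally have "(\<Prod>z\<in>#U \<epsilon>. f + \<epsilon> * w - z) / (\<Prod>z\<in>#U \<epsilon>. f - z) = (\<Prod>v\<in>#V. 1 + v)"
      using nz by (auto simp: prod_mset_zero_iff)
    also have "norm (\<dots> - 1) \<le> (2 ^ size V - 1) * (norm \<epsilon> * (norm w / \<delta>))"
    proof (rule prod_mset_near_one)
      fix v assume "v \<in># V"
      then obtain z where z: "z \<in># U \<epsilon>" "v = \<epsilon> * w / (f - z)" by (auto simp: V_def)
      have pos: "0 < norm (f - z)" using far[OF z(1)] \<open>\<delta> > 0\<close> by linarith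
      have "norm (\<epsilon> * w) / norm (f - z) \<le> norm (\<epsilon> * w) / \<delta>"
        by (intro divide_left_mono far[OF z(1)] mult_pos_pos pos \<open>\<delta> > 0\<close> norm_ge_zero)
      thus "norm v \<le> norm \<epsilon> * (norm w / \<delta>)" by (simp add: z norm_divide norm_mult)
    qed (use elim \<open>\<delta> > 0\<close> in auto)
    also have "\<dots> \<le> 2 ^ N * (norm \<epsilon> * (norm w / \<delta>))"
    proof (rule mult_right_mono)
      have "(2::real) ^ size V \<le> 2 ^ N" using size by (intro power_increasing) (auto simp: V_def)
      thus "(2::real) ^ size V - 1 \<le> 2 ^ N" by linarith
    qed (use \<open>\<delta> > 0\<close> in auto)
    finally show ?case by (simp add: mult_ac)
  qed
qed

text \<open>Writing the two eigenvalues near \<open>f\<close> as \<open>f + \<epsilon> * w1\<close> and \<open>f + \<epsilon> * w2\<close>, the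
  rescaled determinant factors as \<open>(w - w1) * (w - w2)\<close>, times the product \<open>g\<close> of the
  distances to the far eigenvalues, times a ratio that is \<open>1 + O(\<epsilon>)\<close>. Comparing with its
  limit \<open>\<beta> * Q w\<close> gives the quadratic with roots \<open>w1\<close> and \<open>w2\<close> up to the factor
  \<open>\<beta> / g\<close>, which has no limit that is known in advance but is bounded.\<close>

lemma double_eigenvalue_splitting:
  fixes F :: "complex \<Rightarrow> complex ^ 'n ^ 'n" and F0 F1 :: "complex ^ 'n ^ 'n"
  assumes F_rem: "\<forall>\<^sub>F \<epsilon> in at 0. norm (F \<epsilon> - F0 - \<epsilon> *\<^sub>C F1) \<le> K * norm \<epsilon> ^ 2"
    and F0: "diagonal F0" and ij: "i \<noteq> j" and f: "{l. F0 $ l $ l = f} = {i, j}"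
  defines "c \<equiv> (F1 $ i $ i + F1 $ j $ j) / 2"
    and "D \<equiv> ((F1 $ i $ i - F1 $ j $ j) / 2) ^ 2 + F1 $ i $ j * F1 $ j $ i"
  shows "\<exists>lp lm. exponents_associated F f [lp, lm]
             \<and> (\<lambda>\<epsilon>. lp \<epsilon> - (f + \<epsilon> * (c + csqrt D))) \<in> o[at 0](\<lambda>\<epsilon>. \<epsilon>)
             \<and> (\<lambda>\<epsilon>. lm \<epsilon> - (f + \<epsilon> * (c - csqrt D))) \<in> o[at 0](\<lambda>\<epsilon>. \<epsilon>)
             \<and> (D \<noteq> 0 \<longrightarrow>
                   (\<lambda>\<epsilon>. lp \<epsilon> - (f + \<epsilon> * (c + csqrt D))) \<in> O[at 0](\<lambda>\<epsilon>. \<epsilon> ^ 2)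
                 \<and> (\<lambda>\<epsilon>. lm \<epsilon> - (f + \<epsilon> * (c - csqrt D))) \<in> O[at 0](\<lambda>\<epsilon>. \<epsilon> ^ 2))"
proof -
  define s where "s = csqrt D"
  have s2: "s ^ 2 = D" by (simp add: s_def)
  have fij: "F0 $ i $ i = f" "F0 $ j $ j = f" using f by auto
  define \<beta> where "\<beta> = (\<Prod>k\<in>UNIV - {i, j}. f - F0 $ k $ k)"
  have F_lim: "(F \<longlongrightarrow> F0) (at 0)"
  proof (rule Lim_null[THEN iffD2], rule Lim_null_comparison)
    show "\<forall>\<^sub>F \<epsilon> in at 0. norm (F \<epsilon> - F0) \<le> K * norm \<epsilon> ^ 2 + norm \<epsilon> * norm F1"
      using F_rem
    proof eventually_elim
      case (elim \<epsilon>)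
      have "norm (F \<epsilon> - F0) \<le> norm (F \<epsilon> - F0 - \<epsilon> *\<^sub>C F1) + norm (\<epsilon> *\<^sub>C F1)"
        using norm_triangle_ineq[of "F \<epsilon> - F0 - \<epsilon> *\<^sub>C F1" "\<epsilon> *\<^sub>C F1"] by simp
      thus ?case using elim by (simp add: norm_cscale)
    qed
    show "((\<lambda>\<epsilon>::complex. K * norm \<epsilon> ^ 2 + norm \<epsilon> * norm F1) \<longlongrightarrow> 0) (at 0)"
      by (auto intro!: tendsto_eq_intros)
  qed
  have "count (eigenvalues F0) f = 2"
    using ij f by (simp add: count_eigenvalues_diagonal[OF F0])
  then obtain \<delta> where \<delta>: "\<delta> > 0"
    "\<forall>\<^sub>F \<epsilon> in at 0. size {#z \<in># eigenvalues (F \<epsilon>). dist z f < \<delta>#} = 2"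
    using number_of_eigenvalues_near[OF F_lim, of f] by auto
  define near where "near \<epsilon> = {#z \<in># eigenvalues (F \<epsilon>). dist z f < \<delta>#}" for \<epsilon>
  define far where "far \<epsilon> = {#z \<in># eigenvalues (F \<epsilon>). \<not> dist z f < \<delta>#}" for \<epsilon>
  \<comment> \<open>The two eigenvalues are ordered, separately for each \<open>\<epsilon>\<close>, so that half their difference
    is at least as close to \<open>\<epsilon> * s\<close> as to \<open>- \<epsilon> * s\<close>; this selects the branch of the square root.\<close>
  have "\<exists>y z. near \<epsilon> = {#y, z#} \<and> norm ((y - z) / 2 - \<epsilon> * s) \<le> norm ((y - z) / 2 + \<epsilon> * s)"
    if two: "size (near \<epsilon>) = 2" for \<epsilon>
  proof -
    obtain y z where yz: "near \<epsilon> = {#y, z#}"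
    proof -
      obtain y U where U: "near \<epsilon> = add_mset y U"
        using size_eq_Suc_imp_eq_union[of "near \<epsilon>" 1] two by auto
      hence "size U = 1" using two by simp
      then obtain z where "U = {#z#}" using size_1_singleton_mset by blast
      with U show ?thesis by (intro that) auto
    qed
    have zy: "(z - y) / 2 - \<epsilon> * s = - ((y - z) / 2 + \<epsilon> * s)"
      "(z - y) / 2 + \<epsilon> * s = - ((y - z) / 2 - \<epsilon> * s)"
      by (simp_all add: diff_divide_distrib)
    show ?thesis
    proof (cases "norm ((y - z) / 2 - \<epsilon> * s) \<le> norm ((y - z) / 2 + \<epsilon> * s)")
      case True
      thus ?thesis using yz by blast
    next
      case False
      hence "norm ((z - y) / 2 - \<epsilon> * s) \<le> norm ((z - y) / 2 + \<epsilon> * s)"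
        unfolding zy norm_minus_cancel by linarith
      moreover have "near \<epsilon> = {#z, y#}" using yz by simp
      ultimately show ?thesis by blast
    qed
  qed
  then obtain z1 z2 where z: "\<And>\<epsilon>. size (near \<epsilon>) = 2 \<Longrightarrow> near \<epsilon> = {#z1 \<epsilon>, z2 \<epsilon>#}"
    "\<And>\<epsilon>. size (near \<epsilon>) = 2 \<Longrightarrow>
      norm ((z1 \<epsilon> - z2 \<epsilon>) / 2 - \<epsilon> * s) \<le> norm ((z1 \<epsilon> - z2 \<epsilon>) / 2 + \<epsilon> * s)"
    by metis
  have ev2: "\<forall>\<^sub>F \<epsilon> in at 0. size (near \<epsilon>) = 2" using \<delta>(2) by (simp add: near_def)
  define w1 where "w1 \<epsilon> = (z1 \<epsilon> - f) / \<epsilon>" for \<epsilon>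
  define w2 where "w2 \<epsilon> = (z2 \<epsilon> - f) / \<epsilon>" for \<epsilon>
  define g where "g \<epsilon> = (\<Prod>z\<in>#far \<epsilon>. f - z)" for \<epsilon>
  define \<rho> where "\<rho> w \<epsilon> = (\<Prod>z\<in>#far \<epsilon>. f + \<epsilon> * w - z) / g \<epsilon>" for w \<epsilon>
  define R where "R w \<epsilon> = det (mat (f + \<epsilon> * w) - F \<epsilon>) / \<epsilon>\<^sup>2" for w \<epsilon>
  have far_ge: "\<delta> \<le> norm (f - z)" if "z \<in># far \<epsilon>" for z \<epsilon>
    using that by (auto simp: far_def dist_norm norm_minus_commute)
  have size_far: "size (far \<epsilon>) \<le> CARD('n)" for \<epsilon>
    unfolding far_def size_eigenvalues[of "F \<epsilon>", symmetric] by (rule size_mset_mono) simp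
  have \<rho>: "eps_close (\<rho> w) 1" for w
    unfolding \<rho>_def g_def by (rule far_eigenvalues_ratio[OF far_ge size_far \<delta>(1)])
  have g_nz: "g \<epsilon> \<noteq> 0" for \<epsilon>
    using far_ge[of f \<epsilon>] \<delta>(1) by (auto simp: g_def prod_mset_zero_iff)
  \<comment> \<open>The minimum makes the power decreasing in the exponent, whatever the number of far
    eigenvalues.\<close>
  have g_inv: "(\<lambda>\<epsilon>. inverse (g \<epsilon>)) \<in> O[at 0](\<lambda>_. 1)"
  proof (rule bigoI[where c = "inverse (min 1 \<delta> ^ CARD('n))"], rule always_eventually, rule allI)
    fix \<epsilon>
    have "min 1 \<delta> ^ CARD('n) \<le> min 1 \<delta> ^ size (far \<epsilon>)"
      using size_far \<delta>(1) by (intro power_decreasing) auto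
    also have "\<dots> \<le> norm (g \<epsilon>)"
      unfolding g_def using far_ge \<delta>(1) by (intro prod_mset_dist_ge_power) (auto simp: min_le_iff_disj)
    finally show "norm (inverse (g \<epsilon>)) \<le> inverse (min 1 \<delta> ^ CARD('n)) * norm (1 :: complex)"
      using \<delta>(1) by (simp add: norm_inverse le_imp_inverse_le)
  qed
  define d where "d = F1 $ i $ i * F1 $ j $ j - F1 $ i $ j * F1 $ j $ i"
  define Q where "Q w = w\<^sup>2 - 2 * c * w + d" for w
  have R: "eps_close (R w) (\<beta> * Q w)" for w
  proof -
    have "(w - F1 $ i $ i) * (w - F1 $ j $ j) - F1 $ i $ j * F1 $ j $ i = Q w"
      by (simp add: Q_def c_def d_def power2_eq_square algebra_simps add_divide_distrib)
    thus ?thesis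
      using eps_close_rescaled_char_det[OF F_rem F0 ij fij, of w] by (simp add: R_def [abs_def] \<beta>_def)
  qed
  have "(\<lambda>\<epsilon>. (w - w1 \<epsilon>) * (w - w2 \<epsilon>) - \<beta> * inverse (g \<epsilon>) * Q w) \<in> O[at 0](\<lambda>\<epsilon>. \<epsilon>)" for w
  proof -
    have inv: "eps_close (\<lambda>\<epsilon>. inverse (\<rho> w \<epsilon>)) 1" using eps_close_inverse[OF \<rho>] by simp
    have "eps_close (\<lambda>\<epsilon>. R w \<epsilon> * inverse (\<rho> w \<epsilon>)) (\<beta> * Q w * 1)"
      by (intro eps_close_mult R inv)
    hence "(\<lambda>\<epsilon>. (R w \<epsilon> * inverse (\<rho> w \<epsilon>) - \<beta> * Q w) * inverse (g \<epsilon>)) \<in> O[at 0](\<lambda>\<epsilon>. \<epsilon> * 1)"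
      using g_inv unfolding eps_close_def by (intro landau_o.big.mult) auto
    moreover have "\<forall>\<^sub>F \<epsilon> in at 0. (R w \<epsilon> * inverse (\<rho> w \<epsilon>) - \<beta> * Q w) * inverse (g \<epsilon>)
       = (w - w1 \<epsilon>) * (w - w2 \<epsilon>) - \<beta> * inverse (g \<epsilon>) * Q w"
      using ev2 eventually_neq_at_within[of 0] tendsto_imp_eventually_ne[OF eps_close_tendsto[OF \<rho>[of w]] one_neq_zero]
    proof eventually_elim
      case (elim \<epsilon>)
      have "eigenvalues (F \<epsilon>) = {#z1 \<epsilon>, z2 \<epsilon>#} + far \<epsilon>"
        unfolding z(1)[OF elim(1), symmetric] near_def far_def by (simp add: multiset_partition)
      hence "det (mat (f + \<epsilon> * w) - F \<epsilon>) = (f + \<epsilon> * w - z1 \<epsilon>) * (f + \<epsilon> * w - z2 \<epsilon>) * (\<rho> w \<epsilon> * g \<epsilon>)"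
        using g_nz[of \<epsilon>] by (simp add: eigenvalue_product \<rho>_def)
      also have "f + \<epsilon> * w - z1 \<epsilon> = \<epsilon> * (w - w1 \<epsilon>)"
        using elim(2) by (simp add: w1_def field_simps)
      also have "f + \<epsilon> * w - z2 \<epsilon> = \<epsilon> * (w - w2 \<epsilon>)"
        using elim(2) by (simp add: w2_def field_simps)
      finally have "R w \<epsilon> = (w - w1 \<epsilon>) * (w - w2 \<epsilon>) * \<rho> w \<epsilon> * g \<epsilon>"
        using elim(2) by (simp add: R_def power2_eq_square)
      hence E: "R w \<epsilon> * inverse (\<rho> w \<epsilon>) * inverse (g \<epsilon>) = (w - w1 \<epsilon>) * (w - w2 \<epsilon>)"
        using elim(3) g_nz[of \<epsilon>] by (simp flip: divide_inverse)
      have "(R w \<epsilon> * inverse (\<rho> w \<epsilon>) - \<beta> * Q w) * inverse (g \<epsilon>)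
          = R w \<epsilon> * inverse (\<rho> w \<epsilon>) * inverse (g \<epsilon>) - \<beta> * inverse (g \<epsilon>) * Q w"
        by (simp add: algebra_simps)
      thus ?case unfolding E .
    qed
    ultimately show ?thesis
      using landau_o.big.in_cong[of "\<lambda>\<epsilon>. (R w \<epsilon> * inverse (\<rho> w \<epsilon>) - \<beta> * Q w) * inverse (g \<epsilon>)"] by auto
  qed
  hence "\<And>w. (\<lambda>\<epsilon>. (w - w1 \<epsilon>) * (w - w2 \<epsilon>) - \<beta> * inverse (g \<epsilon>) * (w\<^sup>2 - 2 * c * w + d)) \<in> O[at 0](\<lambda>\<epsilon>. \<epsilon>)"
    by (simp add: Q_def)
  note vieta = quadratic_from_three_values[OF this]
  define h where "h \<epsilon> = (w1 \<epsilon> - w2 \<epsilon>) / 2" for \<epsilon>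
  define m where "m \<epsilon> = (w1 \<epsilon> + w2 \<epsilon>) * (1 / 2)" for \<epsilon>
  have m: "eps_close m c"
    using eps_close_mult[OF vieta(1) eps_close_const[of "1 / 2"]] by (simp add: m_def [abs_def])
  have h2: "eps_close (\<lambda>\<epsilon>. h \<epsilon> ^ 2) (s ^ 2)"
  proof -
    have "eps_close (\<lambda>\<epsilon>. m \<epsilon> * m \<epsilon> - w1 \<epsilon> * w2 \<epsilon>) (c * c - d)"
      by (intro eps_close_diff eps_close_mult m vieta(2))
    moreover have "c * c - d = s ^ 2"
      unfolding s2 by (simp add: D_def c_def d_def power2_eq_square field_simps)
    moreover have "(\<lambda>\<epsilon>. m \<epsilon> * m \<epsilon> - w1 \<epsilon> * w2 \<epsilon>) = (\<lambda>\<epsilon>. h \<epsilon> ^ 2)"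
      by (simp add: fun_eq_iff m_def h_def power2_eq_square field_simps)
    ultimately show ?thesis by simp
  qed
  have near_root: "\<forall>\<^sub>F \<epsilon> in at 0. norm (h \<epsilon> - s) \<le> norm (h \<epsilon> + s)"
    using ev2 eventually_neq_at_within[of 0]
  proof eventually_elim
    case (elim \<epsilon>)
    have "(z1 \<epsilon> - z2 \<epsilon>) / 2 = \<epsilon> * h \<epsilon>" using elim(2) by (simp add: h_def w1_def w2_def field_simps)
    hence "norm (\<epsilon> * (h \<epsilon> - s)) \<le> norm (\<epsilon> * (h \<epsilon> + s))"
      using z(2)[OF elim(1)] by (simp add: algebra_simps)
    thus ?case using elim(2) by (simp add: norm_mult)
  qed
  note root = nearer_square_root[OF h2 near_root]
  have eq1: "\<forall>\<^sub>F \<epsilon> in at 0. \<epsilon> * ((m \<epsilon> - c) + (h \<epsilon> - s)) = z1 \<epsilon> - (f + \<epsilon> * (c + s))"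
    using eventually_neq_at_within[of 0]
    by eventually_elim (simp add: m_def h_def w1_def w2_def field_simps)
  have eq2: "\<forall>\<^sub>F \<epsilon> in at 0. \<epsilon> * ((m \<epsilon> - c) - (h \<epsilon> - s)) = z2 \<epsilon> - (f + \<epsilon> * (c - s))"
    using eventually_neq_at_within[of 0]
    by eventually_elim (simp add: m_def h_def w1_def w2_def field_simps)
  have m_lim: "((\<lambda>\<epsilon>. m \<epsilon> - c) \<longlongrightarrow> 0) (at 0)" using eps_close_tendsto[OF m] by (simp add: LIM_zero_iff)
  have h_lim: "((\<lambda>\<epsilon>. h \<epsilon> - s) \<longlongrightarrow> 0) (at 0)" using root(1) by (simp add: LIM_zero_iff)
  have small: "(\<lambda>\<epsilon>. \<epsilon> * r \<epsilon>) \<in> o[at 0](\<lambda>\<epsilon>. \<epsilon>)" if "(r \<longlongrightarrow> 0) (at 0)" for r :: "complex \<Rightarrow> complex"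
  proof -
    have "r \<in> o[at 0](\<lambda>_. 1)" using that by (intro smalloI_tendsto) auto
    hence "(\<lambda>\<epsilon>. \<epsilon> * r \<epsilon>) \<in> o[at 0](\<lambda>\<epsilon>. \<epsilon> * 1)"
      by (intro landau_o.big_small_mult) auto
    thus ?thesis by simp
  qed
  have o1: "(\<lambda>\<epsilon>. z1 \<epsilon> - (f + \<epsilon> * (c + s))) \<in> o[at 0](\<lambda>\<epsilon>. \<epsilon>)"
    using small[OF tendsto_add_zero[OF m_lim h_lim]] landau_o.small.in_cong[OF eq1] by simp
  have o2: "(\<lambda>\<epsilon>. z2 \<epsilon> - (f + \<epsilon> * (c - s))) \<in> o[at 0](\<lambda>\<epsilon>. \<epsilon>)"
    using small[OF tendsto_diff[OF m_lim h_lim, unfolded diff_0_right]] landau_o.small.in_cong[OF eq2] by simp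
  have O12: "(\<lambda>\<epsilon>. z1 \<epsilon> - (f + \<epsilon> * (c + s))) \<in> O[at 0](\<lambda>\<epsilon>. \<epsilon> ^ 2)"
    "(\<lambda>\<epsilon>. z2 \<epsilon> - (f + \<epsilon> * (c - s))) \<in> O[at 0](\<lambda>\<epsilon>. \<epsilon> ^ 2)" if "D \<noteq> 0"
  proof -
    have "s \<noteq> 0" using that by (simp add: s_def)
    hence h: "(\<lambda>\<epsilon>. h \<epsilon> - s) \<in> O[at 0](\<lambda>\<epsilon>. \<epsilon>)" using root(2) by (simp add: eps_close_def)
    have m': "(\<lambda>\<epsilon>. m \<epsilon> - c) \<in> O[at 0](\<lambda>\<epsilon>. \<epsilon>)" using m by (simp add: eps_close_def)
    have "(\<lambda>\<epsilon>. \<epsilon> * ((m \<epsilon> - c) + (h \<epsilon> - s))) \<in> O[at 0](\<lambda>\<epsilon>. \<epsilon> * \<epsilon>)"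
      by (intro landau_o.big.mult sum_in_bigo h m') simp
    thus "(\<lambda>\<epsilon>. z1 \<epsilon> - (f + \<epsilon> * (c + s))) \<in> O[at 0](\<lambda>\<epsilon>. \<epsilon> ^ 2)"
      using landau_o.big.in_cong[OF eq1] by (simp add: power2_eq_square)
    have "(\<lambda>\<epsilon>. \<epsilon> * ((m \<epsilon> - c) - (h \<epsilon> - s))) \<in> O[at 0](\<lambda>\<epsilon>. \<epsilon> * \<epsilon>)"
      by (intro landau_o.big.mult sum_in_bigo h m') simp
    thus "(\<lambda>\<epsilon>. z2 \<epsilon> - (f + \<epsilon> * (c - s))) \<in> O[at 0](\<lambda>\<epsilon>. \<epsilon> ^ 2)"
      using landau_o.big.in_cong[OF eq2] by (simp add: power2_eq_square)
  qed
  have lim: "(l \<longlongrightarrow> f) (at 0)" if l: "(\<lambda>\<epsilon>. l \<epsilon> - (f + \<epsilon> * b)) \<in> o[at 0](\<lambda>\<epsilon>. \<epsilon>)" for l b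
  proof -
    note l
    also have "(\<lambda>\<epsilon>::complex. \<epsilon>) \<in> O[at 0](\<lambda>_. 1 :: complex)"
      by (rule bigoI_tendsto[where c = 0]) (auto intro!: tendsto_eq_intros)
    finally have "((\<lambda>\<epsilon>. l \<epsilon> - (f + \<epsilon> * b)) \<longlongrightarrow> 0) (at 0)" by (auto dest: smalloD_tendsto)
    hence "((\<lambda>\<epsilon>. (l \<epsilon> - (f + \<epsilon> * b)) + (f + \<epsilon> * b)) \<longlongrightarrow> 0 + (f + 0 * b)) (at 0)"
      by (intro tendsto_intros)
    thus ?thesis by simp
  qed
  have "exponents_associated F f [z1, z2]"
    unfolding exponents_associated_def
  proof (intro conjI exI[of _ \<delta>])
    show "\<forall>l\<in>set [z1, z2]. (l \<longlongrightarrow> f) (at 0)" using lim[OF o1] lim[OF o2] by simp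
    show "\<forall>\<^sub>F \<epsilon> in at 0. {#z \<in># eigenvalues (F \<epsilon>). dist z f < \<delta>#} = mset (map (\<lambda>l. l \<epsilon>) [z1, z2])"
      using ev2 by eventually_elim (simp add: z(1) flip: near_def)
  qed (rule \<delta>(1))
  thus ?thesis using o1 o2 O12 unfolding s_def by blast
qed

section \<open>Floquet exponents at a double eigenvalue\<close>

theorem lemma4p7:
  fixes T r0 r :: real
    and A :: "complex \<Rightarrow> real \<Rightarrow> complex ^ 'n ^ 'n"
    and Ac :: "nat \<Rightarrow> real \<Rightarrow> complex ^ 'n ^ 'n"
    and Ahat :: "nat \<Rightarrow> int \<Rightarrow> complex ^ 'n ^ 'n"
    and A0 :: "complex ^ 'n ^ 'n"
    and X P :: "complex \<Rightarrow> real \<Rightarrow> complex ^ 'n ^ 'n"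
    and Pc :: "nat \<Rightarrow> real \<Rightarrow> complex ^ 'n ^ 'n"
    and F :: "complex \<Rightarrow> complex ^ 'n ^ 'n"
    and Fc :: "nat \<Rightarrow> complex ^ 'n ^ 'n"
    and n :: "'n \<Rightarrow> int"
    and i j :: 'n
  assumes "T > 0" and "r0 > 0"
    and A_periodic: "\<And>\<epsilon> t. norm \<epsilon> < r0 \<Longrightarrow> A \<epsilon> (t + T) = A \<epsilon> t"
    and A_continuous: "\<And>\<epsilon>. norm \<epsilon> < r0 \<Longrightarrow> continuous_on UNIV (A \<epsilon>)"
    and A_series: "\<And>\<epsilon>. norm \<epsilon> < r0 \<Longrightarrow>
          uniform_limit UNIV (\<lambda>M t. \<Sum>k<M. \<epsilon> ^ k *\<^sub>C Ac k t) (A \<epsilon>) sequentially"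
    and A0_diagonal: "diagonal A0"
    and A0_constant: "\<And>t. Ac 0 t = A0"
    and Fourier_finite: "\<And>k. k \<ge> 1 \<Longrightarrow> finite {m. Ahat k m \<noteq> 0}"
    and Fourier: "\<And>k t. k \<ge> 1 \<Longrightarrow>
          Ac k t = (\<Sum>m | Ahat k m \<noteq> 0. exp (2 * pi * \<i> * of_int m * t / T) *\<^sub>C Ahat k m)"
    and F0_diagonal: "diagonal (Fc 0)"
    and folding_number: "\<And>k. of_int (n k) = T / (2 * pi * \<i>) * (A0 - Fc 0) $ k $ k"
    and F0_strip: "\<And>k. Im (Fc 0 $ k $ k) \<in> {-pi / T <.. pi / T}"
    and "0 < r" and "r \<le> r0"
    and X_solution: "\<And>\<epsilon> t. norm \<epsilon> < r \<Longrightarrow> (X \<epsilon> has_vector_derivative A \<epsilon> t ** X \<epsilon> t) (at t)"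
    and X_initial: "\<And>\<epsilon>. norm \<epsilon> < r \<Longrightarrow> X \<epsilon> 0 = mat 1"
    and Floquet: "\<And>\<epsilon> t. norm \<epsilon> < r \<Longrightarrow> X \<epsilon> t = P \<epsilon> t ** mexp (t *\<^sub>R F \<epsilon>)"
    and P_periodic: "\<And>\<epsilon> t. norm \<epsilon> < r \<Longrightarrow> P \<epsilon> (t + T) = P \<epsilon> t"
    and P_initial: "\<And>\<epsilon>. norm \<epsilon> < r \<Longrightarrow> P \<epsilon> 0 = mat 1"
    and F_series: "\<And>\<epsilon>. norm \<epsilon> < r \<Longrightarrow> (\<lambda>k. \<epsilon> ^ k *\<^sub>C Fc k) sums F \<epsilon>"
    and P_series: "\<And>\<epsilon> t. norm \<epsilon> < r \<Longrightarrow> (\<lambda>k. \<epsilon> ^ k *\<^sub>C Pc k t) sums P \<epsilon> t"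
    and P0: "\<And>t. Pc 0 t = mexp (t *\<^sub>R (A0 - Fc 0))"
    and "i \<noteq> j" and "Fc 0 $ i $ i = Fc 0 $ j $ j"
    and double_eigenvalue: "count (eigenvalues (Fc 0)) (Fc 0 $ i $ i) = 2"
  shows
    "first_order_effective_hamiltonian (Fc 0) (Fc 1) i (\<lambda>p::2. if p = 1 then i else j)
       (\<lambda>\<epsilon>. vector [vector [Fc 0 $ i $ i, 0],
                    vector [0, Fc 0 $ j $ j]]
           + \<epsilon> *\<^sub>C vector [vector [Ahat 1 0 $ i $ i, Ahat 1 (n i - n j) $ i $ j],
                           vector [Ahat 1 (n j - n i) $ j $ i, Ahat 1 0 $ j $ j]])
     \<and> (let f = Fc 0 $ i $ i;
            c = (Ahat 1 0 $ i $ i + Ahat 1 0 $ j $ j) / 2;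
            D = ((Ahat 1 0 $ i $ i - Ahat 1 0 $ j $ j) / 2) ^ 2
                + Ahat 1 (n i - n j) $ i $ j * Ahat 1 (n j - n i) $ j $ i
        in \<exists>lp lm. exponents_associated F f [lp, lm]
             \<and> (\<lambda>\<epsilon>. lp \<epsilon> - (f + \<epsilon> * (c + csqrt D))) \<in> o[at 0](\<lambda>\<epsilon>. \<epsilon>)
             \<and> (\<lambda>\<epsilon>. lm \<epsilon> - (f + \<epsilon> * (c - csqrt D))) \<in> o[at 0](\<lambda>\<epsilon>. \<epsilon>)
             \<and> (D \<noteq> 0 \<longrightarrow>
                   (\<lambda>\<epsilon>. lp \<epsilon> - (f + \<epsilon> * (c + csqrt D))) \<in> O[at 0](\<lambda>\<epsilon>. \<epsilon> ^ 2)
                 \<and> (\<lambda>\<epsilon>. lm \<epsilon> - (f + \<epsilon> * (c - csqrt D))) \<in> O[at 0](\<lambda>\<epsilon>. \<epsilon> ^ 2)))"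
proof (rule conjI)
  have entry: "Fc 1 $ k $ l = Ahat 1 (n k - n l) $ k $ l" if "Fc 0 $ k $ k = Fc 0 $ l $ l" for k l
  proof (rule first_order_floquet_entry[OF \<open>T > 0\<close> \<open>r0 > 0\<close> A_series A0_diagonal A0_constant
        Fourier_finite Fourier F0_diagonal folding_number \<open>0 < r\<close> X_solution X_initial _ F_series that])
    fix \<epsilon> :: complex assume "norm \<epsilon> < r"
    thus "X \<epsilon> T = mexp (T *\<^sub>R F \<epsilon>)"
      using Floquet[of \<epsilon> T] P_periodic[of \<epsilon> 0] P_initial[of \<epsilon>] by simp
  qed
  have F1: "Fc 1 $ i $ i = Ahat 1 0 $ i $ i" "Fc 1 $ j $ j = Ahat 1 0 $ j $ j"
    "Fc 1 $ i $ j = Ahat 1 (n i - n j) $ i $ j" "Fc 1 $ j $ i = Ahat 1 (n j - n i) $ j $ i"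
    using entry[of i i] entry[of j j] entry[of i j] entry[of j i] \<open>Fc 0 $ i $ i = Fc 0 $ j $ j\<close> by simp_all
  have "card {l. Fc 0 $ l $ l = Fc 0 $ i $ i} = 2"
    using double_eigenvalue count_eigenvalues_diagonal[OF F0_diagonal] by metis
  hence same: "{l. Fc 0 $ l $ l = Fc 0 $ i $ i} = {i, j}"
    using \<open>i \<noteq> j\<close> \<open>Fc 0 $ i $ i = Fc 0 $ j $ j\<close>
    by (intro card_subset_eq[symmetric]) (auto intro: card_ge_0_finite)
  show "first_order_effective_hamiltonian (Fc 0) (Fc 1) i (\<lambda>p::2. if p = 1 then i else j)
       (\<lambda>\<epsilon>. vector [vector [Fc 0 $ i $ i, 0],
                    vector [0, Fc 0 $ j $ j]]
           + \<epsilon> *\<^sub>C vector [vector [Ahat 1 0 $ i $ i, Ahat 1 (n i - n j) $ i $ j],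
                           vector [Ahat 1 (n j - n i) $ j $ i, Ahat 1 0 $ j $ j]])"
    unfolding first_order_effective_hamiltonian_def same
  proof (intro conjI allI)
    show "bij_betw (\<lambda>p::2. if p = 1 then i else j) UNIV {i, j}"
      using \<open>i \<noteq> j\<close> by (auto simp: bij_betw_def inj_on_def UNIV_2)
  qed (use \<open>i \<noteq> j\<close> F0_diagonal in \<open>auto simp: vec_eq_iff forall_2 vector_2 F1[unfolded One_nat_def] diagonal_def\<close>)
  obtain K where "\<forall>\<^sub>F \<epsilon> in at 0. norm (F \<epsilon> - Fc 0 - \<epsilon> *\<^sub>C Fc 1) \<le> K * norm \<epsilon> ^ 2"
    using power_series_first_order[OF \<open>0 < r\<close> F_series] by blast
  from double_eigenvalue_splitting[OF this F0_diagonal \<open>i \<noteq> j\<close> same]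
  show "let f = Fc 0 $ i $ i;
            c = (Ahat 1 0 $ i $ i + Ahat 1 0 $ j $ j) / 2;
            D = ((Ahat 1 0 $ i $ i - Ahat 1 0 $ j $ j) / 2) ^ 2
                + Ahat 1 (n i - n j) $ i $ j * Ahat 1 (n j - n i) $ j $ i
        in \<exists>lp lm. exponents_associated F f [lp, lm]
             \<and> (\<lambda>\<epsilon>. lp \<epsilon> - (f + \<epsilon> * (c + csqrt D))) \<in> o[at 0](\<lambda>\<epsilon>. \<epsilon>)
             \<and> (\<lambda>\<epsilon>. lm \<epsilon> - (f + \<epsilon> * (c - csqrt D))) \<in> o[at 0](\<lambda>\<epsilon>. \<epsilon>)
             \<and> (D \<noteq> 0 \<longrightarrow>
                   (\<lambda>\<epsilon>. lp \<epsilon> - (f + \<epsilon> * (c + csqrt D))) \<in> O[at 0](\<lambda>\<epsilon>. \<epsilon> ^ 2)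
                 \<and> (\<lambda>\<epsilon>. lm \<epsilon> - (f + \<epsilon> * (c - csqrt D))) \<in> O[at 0](\<lambda>\<epsilon>. \<epsilon> ^ 2))"
    unfolding Let_def F1 .
qed

end
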